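(* Let $a\colon\mathbb{N}\to\mathbb{N}\cup\{0\}$ be an additive function and assume the set $\{a(p):p\text{ prime}\}$ is finite. Let $P_0=\{p\in\mathbb{P}:a(p)\neq0\}$ and suppose $\sum_{p\in P_0}1/p=\infty$. Let $X$ be a compact metric space, $T\colon X\to X$ a continuous map, and $\mu$ a Borel probability measure on $X$. If $(X,\mu,T^{a(p)})$ is uniquely ergodic for all $p\in P_0$ (that is, for every $p\in P_0$, $\mu$ is the unique $T^{a(p)}$-invariant Borel probability measure on $X$), then $$\lim_{N\to\infty}\frac1N\sum_{n=1}^N f\big(T^{a(n)}x\big)=\int f\,d\mu$$ for every $f\in C(X)$ and every $x\in X$.
   Context: $\mathbb{N}=\{1,2,3,\ldots\}$ and $\mathbb{P}$ is the set of primes. A function $a$ is additive if $a(nm)=a(n)+a(m)$ for all coprime $n,m\in\mathbb{N}$. $C(X)$ is the space of continuous complex-valued functions on $X$. *)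

theory Defs
  imports "HOL-Probability.Probability" "HOL-Computational_Algebra.Primes"
begin

(* Positivity is required because nat contains 0: coprime 0 1 holds, and the value at 0
   carries no information about a function on the positive integers. *)
definition additive_fun :: "(nat \<Rightarrow> nat) \<Rightarrow> bool" where
  "additive_fun a \<longleftrightarrow> (\<forall>m n. 0 < m \<longrightarrow> 0 < n \<longrightarrow> coprime m n \<longrightarrow> a (m * n) = a m + a n)"

definition borel_prob :: "'a::topological_space measure \<Rightarrow> bool" where
  "borel_prob M \<longleftrightarrow> prob_space M \<and> sets M = sets borel"

(* Measurability is stated because distr is junk for a non-measurable map. *)
definition invariant_measure :: "('a \<Rightarrow> 'a) \<Rightarrow> 'a measure \<Rightarrow> bool" where
  "invariant_measure S M \<longleftrightarrow> S \<in> measurable M M \<and> distr M M S = M"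

definition uniquely_ergodic :: "'a::topological_space measure \<Rightarrow> ('a \<Rightarrow> 'a) \<Rightarrow> bool" where
  "uniquely_ergodic M S \<longleftrightarrow>
     borel_prob M \<and> invariant_measure S M \<and>
     (\<forall>N. borel_prob N \<and> invariant_measure S N \<longrightarrow> N = M)"

end

theory Submission
  imports Defs "HOL-Computational_Algebra.Squarefree"
begin

text \<open>
  Take a limit of the means of \<open>g (T ^^ a n x)\<close> over \<open>n \<le> exp s * N\<close>, as \<open>N\<close> tends to
  infinity along a filter on which all bounded real sequences converge, and call it \<open>U g s\<close>.
  The dual Turan--Kubilius inequality gives
  \<open>U g s \<approx> U (g \<circ> T ^^ a p) (s - ln p)\<close> for all primes outside a set with convergent sum of
  reciprocals. As \<open>a\<close> takes finitely many values on the primes, one can find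
  non-exceptional primes \<open>p\<close>, \<open>q\<close> with \<open>a p = a q\<close> and \<open>ln q - ln p\<close> in a fixed interval
  \<open>[\<delta>, \<epsilon>]\<close>. Comparing the two relations shows that \<open>U g\<close>, which is Lipschitz, has arbitrarily
  small periods and is therefore constant. Then \<open>U (g \<circ> T ^^ c) = U g\<close> for every value \<open>c\<close>
  attained on a set of primes with divergent sum of reciprocals. By the Riesz representation
  theorem \<open>g \<mapsto> U g 0\<close> is integration against an invariant measure, which must be \<open>\<mu>\<close>.
\<close>

text \<open>The obstacle is the change of scale: restricting a mean over \<open>n \<le> N\<close> to
  the multiples of \<open>p\<close> gives a mean over \<open>n \<le> N / p\<close>. A single prime
  thus compares \<open>U\<close> at two different scales, and no invariance can be read off. Hence
  the argument \<open>s\<close>, taken logarithmically so that division by \<open>p\<close> is a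
  translation. Two primes with the same value of \<open>a\<close> eliminate the composition with
  \<open>T ^^ a p\<close> and leave a statement about the translation by \<open>ln q - ln p\<close>
  alone. The exceptional primes depend on \<open>s\<close> and on the tolerance, so \<open>p\<close>
  and \<open>q\<close> change as the tolerance tends to 0. The lower bound \<delta>, fixed
  beforehand, keeps the limit of the gaps from being the useless period 0. Suitable primes are found
  without the prime number theorem: a lower bound of order \<open>ln (ln N)\<close> for the sum of
  \<open>1 / p\<close>, and a binomial coefficient bound for primes in short intervals, are enough.
  A universal filter serves all \<open>g\<close> and all \<open>s\<close> at once, so that
  \<open>U g 0\<close> is linear in \<open>g\<close>.\<close>

section \<open>Riesz representation on a compact metric space\<close>

text \<open>The case distinction is needed because \<open>infdist x {} = 0\<close>.\<close>
definition bump :: "'a::metric_space set \<Rightarrow> nat \<Rightarrow> 'a \<Rightarrow> real" where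
  "bump V n x = (if V = UNIV then 1 else min 1 (real n * infdist x (-V)))"

lemma continuous_bump: "continuous_on UNIV (bump V n)"
  unfolding bump_def[abs_def] by (cases "V = UNIV") (auto intro!: continuous_intros)

lemma bump_bounds: "0 \<le> bump V n x" "bump V n x \<le> indicat_real V x"
  by (auto simp: bump_def indicator_def infdist_nonneg)

lemma eventually_bump_eq_1:
  assumes "open V" "x \<in> V"
  shows "\<exists>n0. \<forall>n\<ge>n0. V = UNIV \<or> real n * infdist x (-V) > 1"
proof (cases "V = UNIV")
  case False
  then have "infdist x (-V) > 0"
    using assms by (intro infdist_pos_not_in_closed) auto
  then obtain n0 where n0: "1 / infdist x (-V) < real n0"
    using reals_Archimedean2 by blast
  have "real n * infdist x (-V) > 1" if "n \<ge> n0" for n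
    using n0 that \<open>infdist x (-V) > 0\<close>
    by (smt (verit) divide_less_eq of_nat_mono)
  then show ?thesis by auto
qed auto

lemma bump_tendsto: "open V \<Longrightarrow> (\<lambda>n. bump V n x) \<longlonglongrightarrow> indicat_real V x"
proof (cases "x \<in> V")
  case True
  assume "open V"
  then obtain n0 where "\<forall>n\<ge>n0. V = UNIV \<or> real n * infdist x (-V) > 1"
    using eventually_bump_eq_1 True by blast
  then have "\<forall>\<^sub>F n in sequentially. bump V n x = indicat_real V x"
    using True by (intro eventually_sequentiallyI[of n0]) (auto simp: bump_def)
  then show ?thesis by (rule tendsto_eventually)
next
  case False
  then have "bump V n x = indicat_real V x" for n
    by (auto simp: bump_def)
  then show ?thesis by simp
qed

lemma ennreal_less_add_pos: "x \<noteq> top \<Longrightarrow> 0 < e \<Longrightarrow> x < x + ennreal e"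
  by (cases x) (auto simp: ennreal_plus[symmetric] ennreal_less_iff simp del: ennreal_plus)

text \<open>The laws are required for continuous arguments only: the functional to which this is
  applied is a limit of means, guaranteed to exist just for bounded functions.\<close>

locale positive_functional =
  fixes I :: "('a::metric_space \<Rightarrow> real) \<Rightarrow> real"
  assumes compact_UNIV: "compact (UNIV :: 'a set)"
    and add: "\<lbrakk>continuous_on UNIV f; continuous_on UNIV g\<rbrakk> \<Longrightarrow> I (\<lambda>x. f x + g x) = I f + I g"
    and scale: "continuous_on UNIV f \<Longrightarrow> I (\<lambda>x. c * f x) = c * I f"
    and nonneg: "\<lbrakk>continuous_on UNIV f; \<And>x. 0 \<le> f x\<rbrakk> \<Longrightarrow> 0 \<le> I f"
    and one: "I (\<lambda>_. 1) = 1"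
begin

lemma diff: "\<lbrakk>continuous_on UNIV f; continuous_on UNIV g\<rbrakk> \<Longrightarrow> I (\<lambda>x. f x - g x) = I f - I g"
  using add[of f "\<lambda>x. (-1) * g x"] scale[of g "-1"] by (simp add: continuous_intros)

lemma mono: "\<lbrakk>continuous_on UNIV f; continuous_on UNIV g; \<And>x. f x \<le> g x\<rbrakk> \<Longrightarrow> I f \<le> I g"
  using nonneg[of "\<lambda>x. g x - f x"] diff[of g f] by (simp add: continuous_intros)

lemma const: "I (\<lambda>_. c) = c"
  using scale[of "\<lambda>_. 1" c] one by simp

lemma add_const: "continuous_on UNIV f \<Longrightarrow> I (\<lambda>x. f x + c) = I f + c"
  using add[of f "\<lambda>_. c"] const by simp

lemma sum: 
  assumes "finite K" "\<And>k. k \<in> K \<Longrightarrow> continuous_on UNIV (f k)"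
  shows "I (\<lambda>x. \<Sum>k\<in>K. f k x) = (\<Sum>k\<in>K. I (f k))"
  using assms by (induction K rule: finite_induct) (simp_all add: const add continuous_on_sum)

section \<open>Content of open sets and the induced outer measure\<close>

definition below :: "'a set \<Rightarrow> ('a \<Rightarrow> real) set" where
  "below V = {g. continuous_on UNIV g \<and> (\<forall>x. 0 \<le> g x \<and> g x \<le> indicat_real V x)}"

definition content :: "'a set \<Rightarrow> ennreal" where
  "content V = (SUP g\<in>below V. ennreal (I g))"

definition outer :: "'a set \<Rightarrow> ennreal" where
  "outer A = (INF V\<in>{V. open V \<and> A \<subseteq> V}. content V)"

lemma below_zero: "(\<lambda>_. 0) \<in> below V"
  by (simp add: below_def)

lemma below_le_1: "g \<in> below V \<Longrightarrow> g x \<le> 1"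
  by (auto simp: below_def intro: order_trans[OF _ indicator_le_1])

lemma bump_below: "bump V n \<in> below V"
proof -
  have "0 \<le> bump V n x \<and> bump V n x \<le> indicat_real V x" for x
    by (auto simp: bump_def indicator_def infdist_nonneg)
  then show ?thesis by (simp add: below_def continuous_bump)
qed

lemma content_mono: "V \<subseteq> W \<Longrightarrow> content V \<le> content W"
  unfolding content_def
  by (intro SUP_subset_mono) (fastforce simp: below_def indicator_def intro: order_trans)+

lemma content_le_1: "content V \<le> 1"
  unfolding content_def
proof (rule SUP_least)
  fix g assume g: "g \<in> below V"
  then have "I g \<le> I (\<lambda>_. 1)"
    using below_le_1[OF g] by (intro mono) (auto simp: below_def)
  then show "ennreal (I g) \<le> 1" by (simp add: one)
qed

lemma content_empty: "content {} = 0"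
proof -
  have "below {} = {\<lambda>_. 0}"
    by (auto simp: below_def fun_eq_iff intro: antisym)
  then show ?thesis by (simp add: content_def const)
qed

lemma content_UNIV: "content UNIV = 1"
proof (rule antisym[OF content_le_1])
  have "ennreal (I (\<lambda>_. 1)) \<le> content UNIV"
    unfolding content_def by (intro SUP_upper) (simp add: below_def)
  then show "1 \<le> content UNIV" by (simp add: one)
qed

lemma outer_open: "open V \<Longrightarrow> outer V = content V"
  unfolding outer_def by (intro antisym INF_lower INF_greatest) (auto intro: content_mono)

lemma outer_mono: "A \<subseteq> B \<Longrightarrow> outer A \<le> outer B"
  unfolding outer_def by (rule INF_superset_mono) auto

text \<open>This replaces the usual demand of compact support inside \<open>V\<close>. A member of
  \<open>below V\<close> merely vanishes outside \<open>V\<close>, but lowering it by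
  \<open>e\<close> and cutting at 0 confines it to the closed set \<open>e \<le> g\<close>, at a
  cost of at most \<open>e\<close> in \<open>I\<close>.\<close>

lemma below_truncate:
  assumes "g \<in> below V" "0 < e"
  shows "continuous_on UNIV (\<lambda>x. max 0 (g x - e))" "I g \<le> I (\<lambda>x. max 0 (g x - e)) + e"
proof -
  have g: "continuous_on UNIV g" using assms by (simp add: below_def)
  show c: "continuous_on UNIV (\<lambda>x. max 0 (g x - e))"
    using g by (intro continuous_intros)
  have "I g \<le> I (\<lambda>x. max 0 (g x - e) + e)"
    using g by (intro mono continuous_intros) auto
  then show "I g \<le> I (\<lambda>x. max 0 (g x - e)) + e"
    using add_const[OF c] by simp
qed

text \<open>After truncation at height \<open>e\<close> only the compact set \<open>K\<close> where
  \<open>e \<le> g\<close> matters. Finitely many \<open>V i\<close> cover it, and the sum of their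
  bumps dominates the truncated function.\<close>

lemma content_UN_le:
  assumes V: "\<And>i. open (V i)"
  shows "content (\<Union>i::nat. V i) \<le> (\<Sum>i. content (V i))"
  unfolding content_def[of "\<Union>i. V i"]
proof (rule SUP_least)
  fix g assume g: "g \<in> below (\<Union>i. V i)"
  have gc: "continuous_on UNIV g" using g by (simp add: below_def)
  show "ennreal (I g) \<le> (\<Sum>i. content (V i))"
  proof (rule ennreal_le_epsilon)
    fix e :: real assume e: "0 < e"
    define K where "K = {x. e \<le> g x}"
    have "closed K"
      unfolding K_def using gc by (intro closed_Collect_le continuous_intros)
    then have K: "compact K"
      using compact_UNIV compact_Int_closed by fastforce
    \<comment> \<open>On \<open>W n\<close> one of the first \<open>n\<close> bumps with parameter
      \<open>n\<close> equals 1. The strict inequality makes these sets open, and they increase with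
      \<open>n\<close>, so a finite subcover of \<open>K\<close> reduces to a single
      \<open>W N\<close>.\<close>
    define W where "W n = (\<Union>i<n. if V i = UNIV then UNIV else {x. 1 < real n * infdist x (- V i)})" for n
    have W_open: "open (W n)" for n
      unfolding W_def by (intro open_UN ballI) (auto intro!: open_Collect_less continuous_intros)
    have W_mono: "W m \<subseteq> W n" if "m \<le> n" for m n
    proof
      fix x assume "x \<in> W m"
      then obtain i where i: "i < m" "V i = UNIV \<or> 1 < real m * infdist x (- V i)"
        unfolding W_def by (auto split: if_splits)
      have "real m * infdist x (- V i) \<le> real n * infdist x (- V i)"
        using that by (intro mult_right_mono) (auto simp: infdist_nonneg)
      with i that show "x \<in> W n"
        unfolding W_def by (intro UN_I[of i]) auto
    qed
    have "K \<subseteq> (\<Union>n. W n)"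
    proof
      fix x assume "x \<in> K"
      then have "0 < g x" using e by (simp add: K_def)
      moreover have "g x \<le> indicat_real (\<Union>i. V i) x"
        using g by (simp add: below_def)
      ultimately have "x \<in> (\<Union>i. V i)"
        by (metis indicator_simps(2) not_less)
      then obtain i where i: "x \<in> V i" by auto
      then obtain n0 where n0: "\<forall>n\<ge>n0. V i = UNIV \<or> real n * infdist x (- V i) > 1"
        using eventually_bump_eq_1 V by blast
      have "x \<in> W (max n0 (Suc i))"
        unfolding W_def using n0[rule_format, of "max n0 (Suc i)"] by (intro UN_I[of i]) auto
      then show "x \<in> (\<Union>n. W n)" by blast
    qed
    then obtain C where C: "finite C" "K \<subseteq> (\<Union>n\<in>C. W n)"
      using compactE_image[OF K, of UNIV W] W_open by auto
    define N where "N = Max (insert 0 C)"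
    have N: "K \<subseteq> W N"
    proof -
      have "W n \<subseteq> W N" if "n \<in> C" for n
        using that C(1) by (intro W_mono) (simp add: N_def)
      then show ?thesis using C(2) by blast
    qed
    have le: "max 0 (g x - e) \<le> (\<Sum>i<N. bump (V i) N x)" for x
    proof (cases "x \<in> K")
      case True
      then obtain i where i: "i < N" "V i = UNIV \<or> 1 < real N * infdist x (- V i)"
        using N unfolding W_def by (auto split: if_splits)
      have "max 0 (g x - e) \<le> 1"
        using below_le_1[OF g, of x] e by simp
      also have "1 = bump (V i) N x"
        using i by (auto simp: bump_def)
      also have "\<dots> \<le> (\<Sum>i<N. bump (V i) N x)"
        using i bump_below by (intro member_le_sum) (auto simp: below_def)
      finally show ?thesis .
    next
      case False
      have "0 \<le> (\<Sum>i<N. bump (V i) N x)"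
        using bump_below by (intro sum_nonneg) (auto simp: below_def)
      with False show ?thesis by (simp add: K_def)
    qed
    have pos: "0 \<le> I (bump (V i) N)" for i
      using bump_below by (intro nonneg continuous_bump) (auto simp: below_def)
    have "I g \<le> I (\<lambda>x. max 0 (g x - e)) + e"
      using below_truncate(2)[OF g e] .
    also have "I (\<lambda>x. max 0 (g x - e)) \<le> I (\<lambda>x. \<Sum>i<N. bump (V i) N x)"
      using le by (intro mono below_truncate(1)[OF g e] continuous_on_sum continuous_bump)
    also have "\<dots> = (\<Sum>i<N. I (bump (V i) N))"
      by (intro sum continuous_bump) auto
    finally have "ennreal (I g) \<le> ennreal ((\<Sum>i<N. I (bump (V i) N)) + e)"
      by (intro ennreal_leI) simp
    also have "\<dots> = (\<Sum>i<N. ennreal (I (bump (V i) N))) + ennreal e"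
      using pos e by (subst ennreal_plus) (auto simp: sum_nonneg sum_ennreal)
    also have "(\<Sum>i<N. ennreal (I (bump (V i) N))) \<le> (\<Sum>i<N. content (V i))"
      unfolding content_def by (intro sum_mono SUP_upper bump_below)
    also have "\<dots> \<le> (\<Sum>i. content (V i))"
      by (intro sum_le_suminf) auto
    finally show "ennreal (I g) \<le> (\<Sum>i. content (V i)) + ennreal e"
      by (simp add: add_mono)
  qed
qed

lemma outer_UN_le: "outer (\<Union>i::nat. A i) \<le> (\<Sum>i. outer (A i))"
proof (rule ennreal_le_epsilon)
  fix e :: real assume e: "0 < e"
  have "\<exists>V. open V \<and> A i \<subseteq> V \<and> content V \<le> outer (A i) + ennreal (e * (1/2) ^ Suc i)" for i
  proof -
    have "outer (A i) \<noteq> \<infinity>"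
      using outer_mono[of "A i" UNIV] by (auto simp: outer_open content_UNIV top_unique)
    then have "outer (A i) < outer (A i) + ennreal (e * (1/2) ^ Suc i)"
      using e by (simp add: ennreal_less_top less_top)
    then show ?thesis
      unfolding outer_def[of "A i"] INF_less_iff by (auto intro: less_imp_le)
  qed
  then obtain V where V: "\<And>i. open (V i)" "\<And>i. A i \<subseteq> V i"
    "\<And>i. content (V i) \<le> outer (A i) + ennreal (e * (1/2) ^ Suc i)"
    by metis
  have "outer (\<Union>i. A i) \<le> content (\<Union>i. V i)"
    unfolding outer_def using V by (intro INF_lower) auto
  also have "\<dots> \<le> (\<Sum>i. content (V i))"
    using V(1) by (rule content_UN_le)
  also have "\<dots> \<le> (\<Sum>i. outer (A i) + ennreal (e * (1/2) ^ Suc i))"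
    using V(3) by (intro suminf_le) auto
  also have "\<dots> = (\<Sum>i. outer (A i)) + (\<Sum>i. ennreal (e * (1/2) ^ Suc i))"
    by (subst suminf_add) auto
  also have "(\<Sum>i. ennreal (e * (1/2) ^ Suc i)) = ennreal e"
    using sums_mult[OF power_half_series, of e] e
    by (intro sums_unique[symmetric] sums_ennreal[THEN iffD2]) auto
  finally show "outer (\<Union>i. A i) \<le> (\<Sum>i. outer (A i)) + ennreal e" .
qed

lemma outer_empty: "outer {} = 0"
  by (simp add: outer_open content_empty)

lemma outer_Un_le: "outer (A \<union> B) \<le> outer A + outer B"
proof -
  have "outer (\<Union>i::nat. if i = 0 then A else if i = 1 then B else {})
    \<le> (\<Sum>i::nat. outer (if i = 0 then A else if i = 1 then B else {}))"
    using outer_UN_le[of "\<lambda>i::nat. if i = 0 then A else if i = 1 then B else {}"] .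
  also have "\<dots> = (\<Sum>i\<in>{0,1::nat}. outer (if i = 0 then A else if i = 1 then B else {}))"
    by (rule suminf_finite) (auto simp: outer_empty)
  also have "\<dots> = outer A + outer B" by simp
  also have "(\<Union>i::nat. if i = 0 then A else if i = 1 then B else {}) = A \<union> B"
    by (auto split: if_splits)
  finally show ?thesis .
qed

text \<open>Near-optimal functions for \<open>V \<inter> U\<close> and for a neighbourhood of
  \<open>V - U\<close> must be added without exceeding 1. Since \<open>g\<close> vanishes on
  \<open>V - U\<close>, the set \<open>W\<close> where \<open>g < e\<close> is such a neighbourhood,
  and there the truncation of \<open>g\<close> at \<open>e\<close> is 0; hence \<open>k\<close>
  still lies below \<open>V\<close>. The three thirds of \<open>e'\<close> pay for two
  approximations and one truncation.\<close>

lemma outer_split_open_le: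
  assumes U: "open U" and V: "open V"
  shows "outer (V \<inter> U) + outer (V - U) \<le> content V"
proof (rule ennreal_le_epsilon)
  fix e' :: real assume e': "0 < e'"
  define e where "e = e' / 3"
  have e: "0 < e" "e' = e + e + e" using e' by (auto simp: e_def)
  have approx: "\<exists>g\<in>below W. content W \<le> ennreal (I g) + ennreal e" for W
  proof -
    have "content W < content W + ennreal e"
      using content_le_1[of W] e(1) by (intro ennreal_less_add_pos) (auto simp: top_unique)
    then have ne: "content W < (SUP g\<in>below W. ennreal (I g) + ennreal e)"
      unfolding content_def using below_zero[of W] 
      by (subst ennreal_SUP_add_left) auto
    then show ?thesis
      unfolding less_SUP_iff by (auto intro: less_imp_le)
  qed
  obtain g where g: "g \<in> below (V \<inter> U)" "content (V \<inter> U) \<le> ennreal (I g) + ennreal e"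
    using approx by blast
  have gc: "continuous_on UNIV g" using g by (simp add: below_def)
  define W where "W = V \<inter> {x. g x < e}"
  have W: "open W"
    unfolding W_def using gc V by (intro open_Int open_Collect_less continuous_intros)
  have VU: "V - U \<subseteq> W"
  proof
    fix x assume x: "x \<in> V - U"
    then have "g x = 0"
      using g(1) by (auto simp: below_def indicator_def intro: antisym dest!: spec[of _ x])
    with x e show "x \<in> W" by (simp add: W_def)
  qed
  obtain h where h: "h \<in> below W" "content W \<le> ennreal (I h) + ennreal e"
    using approx by blast
  have hc: "continuous_on UNIV h" using h by (simp add: below_def)
  define k where "k x = max 0 (g x - e) + h x" for x
  have kb: "k \<in> below V"
  proof -
    have "0 \<le> k x \<and> k x \<le> indicat_real V x" for x
    proof -
      have gx: "0 \<le> g x" "g x \<le> indicat_real (V \<inter> U) x" and hx: "0 \<le> h x" "h x \<le> indicat_real W x"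
        using g h by (auto simp: below_def)
      show ?thesis
      proof (cases "x \<in> W")
        case True
        then show ?thesis using gx hx by (auto simp: W_def k_def)
      next
        case False
        then show ?thesis using gx hx e(1)
          by (cases "x \<in> V"; cases "x \<in> U") (auto simp: k_def)
      qed
    qed
    moreover have "continuous_on UNIV k"
      unfolding k_def[abs_def] using gc hc by (intro continuous_intros)
    ultimately show ?thesis by (simp add: below_def)
  qed
  have I0: "0 \<le> I g" "0 \<le> I h" "0 \<le> I k"
    using g h kb by (auto intro!: nonneg simp: below_def)
  have "I g + I h \<le> I k + e"
    using below_truncate[OF g(1) e(1)] add[OF below_truncate(1)[OF g(1) e(1)] hc]
    unfolding k_def[abs_def] by simp
  then have gh: "ennreal (I g) + ennreal (I h) \<le> ennreal (I k) + ennreal e"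
    using I0 e(1) by (metis ennreal_leI ennreal_plus less_imp_le)
  have "outer (V \<inter> U) + outer (V - U) \<le> content (V \<inter> U) + content W"
    using outer_mono[OF VU] U V W by (intro add_mono) (auto simp: outer_open open_Int)
  also have "\<dots> \<le> (ennreal (I g) + ennreal e) + (ennreal (I h) + ennreal e)"
    using g h by (intro add_mono) auto
  also have "\<dots> = (ennreal (I g) + ennreal (I h)) + (ennreal e + ennreal e)"
    by (simp add: ac_simps)
  also have "\<dots> \<le> (ennreal (I k) + ennreal e) + (ennreal e + ennreal e)"
    by (rule add_right_mono[OF gh])
  also have "\<dots> = ennreal (I k) + ennreal e'"
    using e by (simp add: ennreal_plus[symmetric] ac_simps del: ennreal_plus)
  also have "ennreal (I k) \<le> content V"
    unfolding content_def using kb by (rule SUP_upper)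
  finally show "outer (V \<inter> U) + outer (V - U) \<le> content V + ennreal e'"
    by (simp add: add_mono)
qed

text \<open>This is Caratheodory's condition. As \<open>outer A\<close> is an infimum over open
  supersets of \<open>A\<close>, the splitting of open sets is all that has to be known.\<close>

lemma open_in_lambda_system:
  assumes U: "open U"
  shows "U \<in> lambda_system UNIV (Pow UNIV) outer"
proof -
  have "outer (U \<inter> A) + outer ((UNIV - U) \<inter> A) = outer A" for A
  proof (rule antisym)
    show "outer (U \<inter> A) + outer ((UNIV - U) \<inter> A) \<le> outer A"
      unfolding outer_def[of A]
    proof (rule INF_greatest, clarify)
      fix V assume V: "open V" "A \<subseteq> V"
      have "outer (U \<inter> A) + outer ((UNIV - U) \<inter> A) \<le> outer (V \<inter> U) + outer (V - U)"
        using V by (intro add_mono outer_mono) auto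
      also have "\<dots> \<le> content V"
        using U V(1) by (rule outer_split_open_le)
      finally show "outer (U \<inter> A) + outer ((UNIV - U) \<inter> A) \<le> content V" .
    qed
    have "A = U \<inter> A \<union> (UNIV - U) \<inter> A" by auto
    then show "outer A \<le> outer (U \<inter> A) + outer ((UNIV - U) \<inter> A)"
      using outer_Un_le by metis
  qed
  then show ?thesis by (auto simp: lambda_system_def)
qed

section \<open>The representing measure and integration against it\<close>

definition riesz_measure :: "'a measure" where
  "riesz_measure = measure_of UNIV (sets borel) outer"

lemma sets_riesz_measure [simp, measurable_cong]: "sets riesz_measure = sets borel"
  unfolding riesz_measure_def
  using sets.sigma_sets_eq[of "borel :: 'a measure"] by simp

lemma space_riesz_measure [simp]: "space riesz_measure = UNIV"
  by (simp add: riesz_measure_def space_measure_of_conv)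

lemma emeasure_riesz_measure:
  assumes "A \<in> sets borel"
  shows "emeasure riesz_measure A = outer A"
proof -
  have "outer_measure_space (Pow UNIV) outer"
    by (auto simp: outer_measure_space_def positive_def increasing_def countably_subadditive_def
        outer_empty outer_mono outer_UN_le)
  then have L: "measure_space UNIV (lambda_system UNIV (Pow UNIV) outer) outer"
    using sigma_algebra.caratheodory_lemma[OF sigma_algebra_Pow] by blast
  have "sets borel \<subseteq> lambda_system UNIV (Pow UNIV) outer"
  proof -
    have "sigma_sets UNIV {S :: 'a set. open S} \<subseteq> lambda_system UNIV (Pow UNIV) outer"
      using L open_in_lambda_system
      by (intro sigma_algebra.sigma_sets_subset) (auto simp: measure_space_def)
    then show ?thesis by (simp add: borel_def)
  qed
  then have "measure_space UNIV (sets borel) outer"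
    using L sets.sigma_algebra_axioms[of "borel :: 'a measure"]
    by (intro measure_down[OF L]) auto
  then show ?thesis
    unfolding riesz_measure_def using assms
    by (intro emeasure_measure_of_sigma) (auto simp: measure_space_def)
qed

lemma prob_space_riesz_measure: "prob_space riesz_measure"
  by (rule prob_spaceI) (simp add: emeasure_riesz_measure outer_open content_UNIV)

lemma integrable_riesz_measure: "continuous_on UNIV f \<Longrightarrow> integrable riesz_measure (f :: 'a \<Rightarrow> real)"
proof -
  assume f: "continuous_on UNIV f"
  interpret prob_space riesz_measure by (rule prob_space_riesz_measure)
  have "compact (range f)" using f compact_UNIV by (rule compact_continuous_image)
  then obtain B where "\<And>x. \<bar>f x\<bar> \<le> B"
    using compact_imp_bounded by (force simp: bounded_iff)
  then show ?thesis
    using borel_measurable_continuous_onI[OF f]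
    by (intro integrable_const_bound[of _ B]) (auto simp: measurable_cong_sets[OF sets_riesz_measure refl])
qed

text \<open>Cut \<open>f\<close> into \<open>n\<close> horizontal slices. The functional of a slice
  is at most the measure of the level set at its bottom, its integral at least that of the level set
  at its top, and consecutive slices share a level.\<close>

lemma le_integral_aux:
  assumes f: "continuous_on UNIV f" and f01: "\<And>x. 0 \<le> f x" "\<And>x. f x \<le> 1"
  shows "I f \<le> integral\<^sup>L riesz_measure f"
proof -
  interpret prob_space riesz_measure by (rule prob_space_riesz_measure)
  have *: "I f \<le> integral\<^sup>L riesz_measure f + 1 / real n" if n: "n > 0" for n
  proof -
    define S where "S k = {x. real k / real n < f x}" for k
    \<comment> \<open>\<open>g k\<close> is the part of \<open>n * f\<close> between the heights
      \<open>k\<close> and \<open>k + 1\<close>, so it lies between the indicators of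
      \<open>S (Suc k)\<close> and \<open>S k\<close>.\<close>
    define g where "g k x = min 1 (max 0 (real n * f x - real k))" for k x
    have S: "open (S k)" for k
      unfolding S_def using f by (intro open_Collect_less continuous_intros)
    have gc: "continuous_on UNIV (g k)" for k
      unfolding g_def[abs_def] using f by (intro continuous_intros)
    have gS: "g k \<in> below (S k)" for k
      using gc n by (auto simp: below_def g_def S_def indicator_def field_simps)
    have g_ge: "indicat_real (S (Suc k)) x \<le> g k x" for k x
      using n by (auto simp: g_def S_def indicator_def field_simps)
    have tele: "(\<Sum>k<m. g k x) = min (real m) (real n * f x)" for m x
      using f01(1)[of x] by (induction m) (auto simp: g_def min_def max_def)
    have f_eq: "f x = (\<Sum>k<n. (1 / real n) * g k x)" for x
      using n f01(2)[of x] tele[of x n] by (simp add: sum_divide_distrib[symmetric] min_def field_simps)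
    have Ig: "I (g k) \<le> prob (S k)" for k
    proof -
      have "ennreal (I (g k)) \<le> emeasure riesz_measure (S k)"
        using gS S by (auto simp: emeasure_riesz_measure outer_open content_def intro: SUP_upper)
      then show ?thesis
        by (simp add: emeasure_eq_measure)
    qed
    have gI: "prob (S (Suc k)) \<le> integral\<^sup>L riesz_measure (g k)" for k
    proof -
      have "(\<integral>x. indicat_real (S (Suc k)) x \<partial>riesz_measure) \<le> integral\<^sup>L riesz_measure (g k)"
        using g_ge S integrable_riesz_measure[OF gc]
        by (intro integral_mono) (auto simp: less_top[symmetric])
      then show ?thesis using S by simp
    qed
    have "I f = (\<Sum>k<n. (1 / real n) * I (g k))"
      by (subst f_eq[abs_def], subst sum) (auto intro!: continuous_intros gc simp: scale[OF gc, of "1/real n", simplified])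
    also have "\<dots> \<le> (\<Sum>k<n. (1 / real n) * prob (S k))"
      using Ig by (intro sum_mono mult_left_mono) auto
    also have "\<dots> = (1 / real n) * (\<Sum>k<n. prob (S k))"
      by (simp add: sum_distrib_left)
    \<comment> \<open>Shifting the index costs at most \<open>prob (S 0) \<le> 1\<close>, which is
      \<open>1 / n\<close> after rescaling.\<close>
    also have "(\<Sum>k<n. prob (S k)) \<le> prob (S 0) + (\<Sum>k<n. prob (S (Suc k)))"
      using sum.lessThan_Suc_shift[of "\<lambda>k. prob (S k)" n] by simp (metis add_increasing2 measure_nonneg order_refl)
    also have "prob (S 0) + (\<Sum>k<n. prob (S (Suc k))) \<le> 1 + (\<Sum>k<n. integral\<^sup>L riesz_measure (g k))"
      using gI by (intro add_mono sum_mono) auto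
    also have "(\<Sum>k<n. integral\<^sup>L riesz_measure (g k)) = real n * integral\<^sup>L riesz_measure f"
    proof -
      have "real n * integral\<^sup>L riesz_measure f = integral\<^sup>L riesz_measure (\<lambda>x. \<Sum>k<n. g k x)"
      proof -
        have "real n * f x = (\<Sum>k<n. g k x)" for x
          using n f01(2)[of x] by (simp add: tele)
        then show ?thesis
          by (simp flip: integral_mult_right_zero)
      qed
      then show ?thesis
        using integrable_riesz_measure[OF gc] by simp
    qed
    finally show ?thesis using n by (simp add: field_simps)
  qed
  show ?thesis
  proof (rule field_le_epsilon)
    fix e :: real assume "0 < e"
    then obtain n where "n > 0" "inverse (real n) < e"
      using ex_inverse_of_nat_less by blast
    then show "I f \<le> integral\<^sup>L riesz_measure f + e"
      using *[of n] by (simp add: inverse_eq_divide)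
  qed
qed

text \<open>One inequality for functions with values in the unit interval suffices: it is applied to
  both \<open>c * f + 1/2\<close> and \<open>- c * f + 1/2\<close>, where \<open>c\<close> is small
  enough that the values stay in range.\<close>

theorem riesz_representation:
  assumes f: "continuous_on UNIV f"
  shows "integral\<^sup>L riesz_measure f = I f"
proof -
  interpret prob_space riesz_measure by (rule prob_space_riesz_measure)
  have "compact (range f)" using f compact_UNIV by (rule compact_continuous_image)
  then obtain B0 where B0: "\<And>x. \<bar>f x\<bar> \<le> B0"
    using compact_imp_bounded by (force simp: bounded_iff)
  define B where "B = max 1 B0"
  have B: "B > 0" "\<And>x. \<bar>f x\<bar> \<le> B" using B0 by (auto simp: B_def intro: max.coboundedI2)
  define c where "c = 1 / (2 * B)"
  have c: "c > 0" "c * B = 1 / 2" using B by (auto simp: c_def)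
  have cf: "\<bar>c * f x\<bar> \<le> 1 / 2" for x
    using mult_left_mono[OF B(2)[of x], of c] c by (simp add: abs_mult)
  have ub: "s * I f \<le> s * integral\<^sup>L riesz_measure f" if s: "s = c \<or> s = - c" for s
  proof -
    have sf: "\<bar>s * f x\<bar> \<le> 1 / 2" for x using cf[of x] s by auto
    have "I (\<lambda>x. s * f x + 1/2) \<le> integral\<^sup>L riesz_measure (\<lambda>x. s * f x + 1/2)"
    proof (rule le_integral_aux)
      show "continuous_on UNIV (\<lambda>x. s * f x + 1 / 2)" using f by (intro continuous_intros)
      show "0 \<le> s * f x + 1 / 2" "s * f x + 1 / 2 \<le> 1" for x using sf[of x] by linarith+
    qed
    also have "I (\<lambda>x. s * f x + 1/2) = s * I f + 1/2"
      using f by (subst add_const) (auto intro!: continuous_intros simp: scale)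
    also have "integral\<^sup>L riesz_measure (\<lambda>x. s * f x + 1/2) = s * integral\<^sup>L riesz_measure f + 1/2"
      using integrable_riesz_measure[OF f] by (simp add: prob_space[simplified])
    finally show ?thesis by simp
  qed
  from ub[of c] ub[of "-c"] c show ?thesis by simp
qed

end

text \<open>Open sets form an intersection-stable generator of the Borel sets, and the measure of an
  open \<open>V\<close> is the limit of the integrals of \<open>bump V n\<close> by dominated
  convergence.\<close>

lemma borel_prob_eqI:
  fixes M N :: "'a::metric_space measure"
  assumes M: "borel_prob M" and N: "borel_prob N"
    and eq: "\<And>f :: 'a \<Rightarrow> real. continuous_on UNIV f \<Longrightarrow> integral\<^sup>L M f = integral\<^sup>L N f"
  shows "M = N"
proof -
  interpret M: prob_space M using M by (simp add: borel_prob_def)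
  interpret N: prob_space N using N by (simp add: borel_prob_def)
  have sets [measurable_cong]: "sets M = sets borel" "sets N = sets borel" using M N by (auto simp: borel_prob_def)
  have sp: "space M = UNIV" "space N = UNIV" using sets by (auto dest!: sets_eq_imp_space_eq)
  show ?thesis
  proof (rule measure_eqI_generator_eq[where E = "{S. open S}" and \<Omega> = UNIV and A = "\<lambda>_. UNIV"])
    show "Int_stable {S :: 'a set. open S}" by (auto simp: Int_stable_def)
    show "sets M = sigma_sets UNIV {S. open S}" "sets N = sigma_sets UNIV {S. open S}"
      using sets by (auto simp: borel_def)
    fix V :: "'a set" assume "V \<in> {S. open S}"
    then have V: "open V" by simp
    have "(\<lambda>n. integral\<^sup>L M (bump V n)) \<longlonglongrightarrow> (\<integral>x. indicat_real V x \<partial>M)"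
      if "prob_space M" and [measurable_cong]: "sets M = sets borel" for M :: "'a measure"
    proof (rule integral_dominated_convergence[where w = "\<lambda>_. 1"])
      interpret prob_space M by fact
      show "integrable M (\<lambda>_. 1 :: real)" by simp
      show "AE x in M. norm (bump V n x) \<le> 1" for n
        using bump_bounds[of V n] by (intro AE_I2) (auto intro: order_trans[OF _ indicator_le_1])
      show "bump V n \<in> borel_measurable M" for n
        using borel_measurable_continuous_onI[OF continuous_bump] by measurable
      show "indicat_real V \<in> borel_measurable M"
        by (rule borel_measurable_indicator) (simp add: V that(2))
    qed (use V bump_tendsto in auto)
    from this[OF M.prob_space_axioms sets(1)] this[OF N.prob_space_axioms sets(2)]
    have "(\<integral>x. indicat_real V x \<partial>M) = (\<integral>x. indicat_real V x \<partial>N)"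
      using eq[OF continuous_bump] by (auto intro: LIMSEQ_unique)
    then have "emeasure M V = emeasure N V"
      using V sets by (simp add: M.emeasure_eq_measure N.emeasure_eq_measure)
    then show "emeasure M V = emeasure N V" .
  qed auto
qed

section \<open>Sums of reciprocals of primes\<close>

lemma sum_inverse_squares_le: "(\<Sum>s=1..N. 1 / (real s)\<^sup>2) \<le> 2"
proof -
  have "N \<ge> 1 \<Longrightarrow> (\<Sum>s=1..N. 1 / (real s)\<^sup>2) \<le> 2 - 1 / real N"
  proof (induction N rule: nat_induct_at_least)
    case (Suc N)
    have "1 / (real (Suc N))\<^sup>2 \<le> 1 / (real N * real (Suc N))"
      using Suc.hyps unfolding power2_eq_square by (intro divide_left_mono mult_right_mono) auto
    also have "\<dots> = 1 / real N - 1 / real (Suc N)"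
      using Suc.hyps by (simp add: field_simps)
    finally show ?case using Suc.IH by simp
  qed simp
  then show ?thesis by (cases "N = 0") (auto intro: order_trans)
qed

lemma sum_inverse_squares_finite_le: "finite F \<Longrightarrow> (\<Sum>p\<in>F. 1 / (real p)\<^sup>2) \<le> 2"
proof -
  assume F: "finite F"
  have "(\<Sum>p\<in>F. 1 / (real p)\<^sup>2) = (\<Sum>p\<in>F - {0}. 1 / (real p)\<^sup>2)"
    using F by (intro sum.mono_neutral_right) auto
  also have "\<dots> \<le> (\<Sum>p=1..Max (insert 0 F). 1 / (real p)\<^sup>2)"
    using F by (intro sum_mono2) (auto simp: Suc_le_eq)
  also have "\<dots> \<le> 2" by (rule sum_inverse_squares_le)
  finally show ?thesis .
qed

text \<open>Expanding the product of \<open>1 + 1 / p\<close> over the primes up to \<open>N\<close>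
  produces \<open>1 / q\<close> for every squarefree \<open>q \<le> N\<close>, because
  \<open>q\<close> is the product of its set of prime factors. Then
  \<open>1 + x \<le> exp x\<close>.\<close>

lemma sum_inverse_squarefree_le:
  "(\<Sum>q | q \<le> N \<and> squarefree q. 1 / real q) \<le> exp (\<Sum>p | prime p \<and> p \<le> N. 1 / real p)"
proof -
  let ?Q = "{q :: nat. q \<le> N \<and> squarefree q}" and ?A = "{p :: nat. prime p \<and> p \<le> N}"
  have prod_pf: "\<Prod>(prime_factors q) = q" if "squarefree q" for q :: nat
  proof -
    have "q \<noteq> 0" using that by (intro notI) simp
    then have "q = (\<Prod>p\<in>prime_factors q. p ^ multiplicity p q)"
      by (intro prime_factorization_nat) simp
    also have "\<dots> = \<Prod>(prime_factors q)"
      using that squarefree_factorial_semiring'[OF \<open>q \<noteq> 0\<close>] by (intro prod.cong) auto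
    finally show ?thesis by simp
  qed
  have inj: "inj_on prime_factors ?Q"
    using prod_pf by (intro inj_onI) (metis (mono_tags, lifting) mem_Collect_eq)
  have sub: "prime_factors ` ?Q \<subseteq> Pow ?A"
    by (auto intro: order_trans[OF dvd_imp_le] simp: prime_factors_dvd intro!: Nat.gr0I)
  have "(\<Sum>q\<in>?Q. 1 / real q) = (\<Sum>q\<in>?Q. \<Prod>p\<in>prime_factors q. 1 / real p)"
    using prod_pf by (intro sum.cong) (auto simp: prod_dividef simp flip: of_nat_prod)
  also have "\<dots> = (\<Sum>B\<in>prime_factors ` ?Q. \<Prod>p\<in>B. 1 / real p)"
    by (simp add: sum.reindex[OF inj])
  also have "\<dots> \<le> (\<Sum>B\<in>Pow ?A. \<Prod>p\<in>B. 1 / real p)"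
    by (intro sum_mono2[OF _ sub]) (auto intro: prod_nonneg)
  also have "\<dots> = (\<Prod>p\<in>?A. 1 / real p + 1)"
    by (subst prod_add) simp_all
  also have "\<dots> \<le> (\<Prod>p\<in>?A. exp (1 / real p))"
    by (intro prod_mono) (auto simp: add.commute[of _ 1] intro: exp_ge_add_one_self)
  also have "\<dots> = exp (\<Sum>p\<in>?A. 1 / real p)"
    by (simp add: exp_sum)
  finally show ?thesis .
qed

text \<open>Writing \<open>n = q * s^2\<close> with \<open>q\<close> squarefree bounds the harmonic
  sum by the squarefree sum times the sum of \<open>1 / s^2\<close>, which is at most 2. Taking
  logarithms shows that the sum of \<open>1 / p\<close> is at least
  \<open>ln (ln (N + 1)) - ln 2\<close>.\<close>

lemma ln_le_exp_sum_inverse_primes: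
  "ln (real N + 1) \<le> 2 * exp (\<Sum>p | prime p \<and> p \<le> N. 1 / real p)"
proof -
  let ?Q = "{q :: nat. q \<le> N \<and> squarefree q}"
  let ?d = "\<lambda>n :: nat. (squarefree_part n, square_part n)"
  have inj: "inj_on ?d {1..N}"
  proof (rule inj_onI)
    fix m n assume "?d m = ?d n"
    then show "m = n"
      using squarefree_decompose[of m] squarefree_decompose[of n] by simp
  qed
  have sub: "?d ` {1..N} \<subseteq> ?Q \<times> {1..N}"
  proof (rule image_subsetI)
    fix n assume n: "n \<in> {1..N}"
    have "squarefree_part n dvd n"
      using squarefree_decompose[of n] by (rule dvdI)
    moreover have "square_part n dvd n"
      using square_part_square_dvd[of n] by (rule dvd_trans[rotated]) simp
    ultimately have "squarefree_part n \<le> n" "square_part n \<le> n" "square_part n \<noteq> 0"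
      using n by (auto intro: dvd_imp_le simp: square_part_0_iff)
    then show "?d n \<in> ?Q \<times> {1..N}"
      using n by (auto simp: Suc_le_eq intro!: Nat.gr0I)
  qed
  have "ln (real N + 1) \<le> (\<Sum>n=1..N. 1 / real n)"
    using ln_le_harm[of N] by (simp add: harm_def inverse_eq_divide)
  also have "\<dots> = (\<Sum>n=1..N. case ?d n of (q, s) \<Rightarrow> 1 / real q * (1 / (real s)\<^sup>2))"
  proof (intro sum.cong refl)
    fix n :: nat
    have "real n = real (squarefree_part n) * (real (square_part n))\<^sup>2"
      by (metis of_nat_mult of_nat_power squarefree_decompose)
    then show "1 / real n = (case ?d n of (q, s) \<Rightarrow> 1 / real q * (1 / (real s)\<^sup>2))"
      by simp
  qed
  also have "\<dots> = (\<Sum>(q, s)\<in>?d ` {1..N}. 1 / real q * (1 / (real s)\<^sup>2))"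
    by (subst sum.reindex[OF inj]) (simp only: o_def)
  also have "\<dots> \<le> (\<Sum>(q, s)\<in>?Q \<times> {1..N}. 1 / real q * (1 / (real s)\<^sup>2))"
    by (intro sum_mono2[OF _ sub]) auto
  also have "\<dots> = (\<Sum>q\<in>?Q. 1 / real q) * (\<Sum>s=1..N. 1 / (real s)\<^sup>2)"
    by (simp add: sum_product sum.cartesian_product)
  also have "\<dots> \<le> exp (\<Sum>p | prime p \<and> p \<le> N. 1 / real p) * 2"
    by (intro mult_mono sum_inverse_squarefree_le sum_inverse_squares_le) (auto intro: sum_nonneg)
  finally show ?thesis by simp
qed

section \<open>Upper bound for the primes in a short interval\<close>

lemma power_card_primes_le_binomial:
  fixes y k :: nat
  assumes "k < y" "1 \<le> y"
  shows "y ^ card {p. prime p \<and> y \<le> p \<and> p < y + k} \<le> (y - 1 + k) choose k"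
proof -
  let ?S = "{p. prime p \<and> y \<le> p \<and> p < y + k}"
  define n where "n = y - 1"
  have fin: "finite ?S" by simp
  \<comment> \<open>The primes counted divide the numerator \<open>y * ... * (y + k - 1)\<close> of
    the binomial coefficient, and none divides \<open>fact k\<close> because
    \<open>k < y \<le> p\<close>.\<close>
  have dvd: "p dvd (n + k choose k)" if "p \<in> ?S" for p
  proof -
    have p: "prime p" "n < p" "k < p" "p \<le> n + k" using that assms by (auto simp: n_def)
    have "fact k * fact n * (n + k choose k) = (fact (n + k) :: nat)"
      using binomial_fact_lemma[of k "n + k"] by simp
    moreover have "p dvd fact (n + k)" using p by (simp add: prime_dvd_fact_iff)
    moreover have "\<not> p dvd fact k" "\<not> p dvd fact n" using p by (simp_all add: prime_dvd_fact_iff)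
    ultimately show ?thesis using p(1) by (metis prime_dvd_mult_iff)
  qed
  have "\<Prod>F dvd (n + k choose k)" if "F \<subseteq> ?S" for F
    using finite_subset[OF that fin] that
  proof (induction F rule: finite_induct)
    case (insert p F)
    have "coprime p (\<Prod>F)"
      using insert by (intro prod_coprime_right primes_coprime) auto
    then show ?case
      using insert dvd[of p] by (simp add: divides_mult)
  qed simp
  then have "\<Prod>?S \<le> (n + k choose k)"
    by (intro dvd_imp_le) auto
  moreover have "(\<Prod>p\<in>?S. y) \<le> \<Prod>?S"
    by (intro prod_mono) auto
  ultimately show ?thesis by (simp add: n_def)
qed

text \<open>Let the interval have length \<open>k\<close> and contain \<open>c\<close> primes. Then
  \<open>y ^ c\<close> is at most the binomial coefficient, which is at most
  \<open>exp (2 * t * y) / t ^ k\<close> for every \<open>t\<close> in (0, 1). Logarithms give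
  \<open>c * ln y \<le> 2 * t * y + k * ln (1 / t)\<close>. Choosing \<open>t\<close> first, and
  then \<open>k / y\<close> small in terms of \<open>t\<close>, makes the right side at most
  \<open>\<kappa> * y\<close>.\<close>

lemma sum_inverse_primes_short_interval:
  fixes \<kappa> :: real
  assumes "0 < \<kappa>"
  shows "\<exists>\<delta>>0. \<exists>y0. \<forall>y\<ge>y0. (\<Sum>p | prime p \<and> y \<le> p \<and> real p \<le> real y * exp \<delta>. 1 / real p) \<le> \<kappa> / ln (real y)"
proof -
  \<comment> \<open>Half of \<open>\<kappa> * y\<close> is reserved for \<open>2 * t * y\<close>;
    the choices of \<eta> and \<open>y0\<close> spend the other half on
    \<open>k * l\<close>.\<close>
  define t where "t = min (\<kappa> / 4) (1 / 2)"
  have t: "0 < t" "t < 1" "4 * t \<le> \<kappa>" using assms by (auto simp: t_def)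
  define l where "l = ln (1 / t)"
  have l: "0 < l" unfolding l_def using t by (subst ln_gt_zero_iff) auto
  define \<eta> where "\<eta> = min (1 / 2) (\<kappa> / (4 * l))"
  have \<eta>: "0 < \<eta>" "\<eta> \<le> 1 / 2" using assms l by (auto simp: \<eta>_def)
  have \<eta>l: "\<eta> * l \<le> \<kappa> / 4"
  proof -
    have "\<eta> * l \<le> \<kappa> / (4 * l) * l" using l by (intro mult_right_mono) (auto simp: \<eta>_def)
    then show ?thesis using l by simp
  qed
  \<comment> \<open>The bound 4 yields \<open>k < y\<close> from \<open>k \<le> y / 2 + 1\<close>;
    the other bound absorbs the extra \<open>l\<close> caused by the \<open>Suc\<close> in
    \<open>k\<close>.\<close>
  define y0 where "y0 = max 4 (nat \<lceil>4 * l / \<kappa>\<rceil>)"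
  have exp\<eta>: "exp (ln (1 + \<eta>)) = 1 + \<eta>" using \<eta> by simp
  have main: "(\<Sum>p | prime p \<and> y \<le> p \<and> real p \<le> real y * exp (ln (1 + \<eta>)). 1 / real p) \<le> \<kappa> / ln (real y)"
    if "y \<ge> y0" for y
  proof -
    have y: "4 \<le> y" "4 * l / \<kappa> \<le> real y" using that by (auto simp: y0_def)
    then have ly: "l \<le> \<kappa> / 4 * real y" using assms by (simp add: field_simps)
    define k where "k = Suc (nat \<lfloor>real y * \<eta>\<rfloor>)"
    have k: "real k \<le> real y * \<eta> + 1" "real y * \<eta> < real k"
      using \<eta> by (auto simp: k_def) linarith+
    have "real y * \<eta> \<le> real y * (1/2)" using \<eta> by (intro mult_left_mono) auto
    with k y have ky: "k < y" "y - 1 + k \<le> 2 * y" by linarith+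
    define c where "c = card {p. prime p \<and> y \<le> p \<and> p < y + k}"
    have sub: "{p. prime p \<and> y \<le> p \<and> real p \<le> real y * exp (ln (1 + \<eta>))} \<subseteq> {p. prime p \<and> y \<le> p \<and> p < y + k}"
    proof clarify
      fix p assume "real p \<le> real y * exp (ln (1 + \<eta>))"
      then have "real p < real (y + k)" using k \<eta> unfolding exp\<eta> by (simp add: algebra_simps)
      then show "p < y + k" by simp
    qed
    have "real (y ^ c) \<le> real (y - 1 + k choose k)"
      using power_card_primes_le_binomial[of k y] ky y unfolding c_def of_nat_le_iff by simp
    moreover have "real (y - 1 + k choose k) * t ^ k \<le> exp (t * (2 * real y))"
    proof -
      \<comment> \<open>The binomial coefficient times \<open>t ^ k\<close> is one summand of the
        expansion of \<open>(t + 1) ^ (y - 1 + k)\<close>.\<close>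
      have "real (y - 1 + k choose k) * t ^ k * 1 ^ (y - 1 + k - k) \<le> (\<Sum>j\<le>y - 1 + k. real (y - 1 + k choose j) * t ^ j * 1 ^ (y - 1 + k - j))"
        using t by (intro member_le_sum) auto
      also have "\<dots> = (t + 1) ^ (y - 1 + k)"
        by (rule binomial_ring[symmetric])
      also have "\<dots> \<le> exp t ^ (y - 1 + k)"
        using t by (intro power_mono) (auto simp: add.commute)
      also have "\<dots> = exp (t * real (y - 1 + k))"
        by (simp add: exp_of_nat_mult[symmetric] mult.commute)
      also have "\<dots> \<le> exp (t * (2 * real y))"
      proof -
        have "real (y - 1 + k) \<le> 2 * real y" using ky(2) by linarith
        then show ?thesis using t by (simp only: exp_le_cancel_iff mult_left_mono less_imp_le)
      qed
      finally show ?thesis by simp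
    qed
    ultimately have "real y ^ c * t ^ k \<le> exp (t * (2 * real y))"
      using t by (smt (verit) mult_right_mono of_nat_power zero_less_power)
    then have "ln (real y ^ c * t ^ k) \<le> t * (2 * real y)"
      using t y by (subst exp_le_cancel_iff[symmetric]) simp
    then have "real c * ln (real y) \<le> t * (2 * real y) + real k * l"
      using t y by (simp add: ln_mult ln_realpow l_def ln_div)
    also have "\<dots> \<le> \<kappa> * real y"
    proof -
      have "4 * t * real y \<le> \<kappa> * real y" using t by (intro mult_right_mono) auto
      moreover have "real k * l \<le> (real y * \<eta> + 1) * l" using k l by (intro mult_right_mono) auto
      moreover have "real y * (\<eta> * l) \<le> real y * (\<kappa> / 4)" using \<eta>l by (intro mult_left_mono) auto
      ultimately show ?thesis using ly by (simp add: algebra_simps)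
    qed
    finally have c: "real c * ln (real y) \<le> \<kappa> * real y" .
    have "(\<Sum>p | prime p \<and> y \<le> p \<and> real p \<le> real y * exp (ln (1 + \<eta>)). 1 / real p)
      \<le> (\<Sum>p | prime p \<and> y \<le> p \<and> p < y + k. 1 / real p)"
      using sub by (intro sum_mono2) auto
    also have "\<dots> \<le> (\<Sum>p | prime p \<and> y \<le> p \<and> p < y + k. 1 / real y)"
      using y by (intro sum_mono divide_left_mono) auto
    also have "\<dots> = real c / real y" by (simp add: c_def)
    also have "\<dots> \<le> \<kappa> / ln (real y)" using c y by (simp add: field_simps)
    finally show ?thesis .
  qed
  have "ln (1 + \<eta>) > 0" using \<eta> by simp
  with main show ?thesis by blast
qed

section \<open>Primes of equal colour at moderate logarithmic distance\<close>

lemma summable_on_finite_UN: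
  fixes f :: "'a \<Rightarrow> real"
  assumes "finite J" "\<And>i. i \<in> J \<Longrightarrow> f summable_on G i"
  shows "f summable_on (\<Union>i\<in>J. G i)"
  using assms
proof (induction J rule: finite_induct)
  case (insert i J)
  let ?U = "\<Union>i\<in>J. G i"
  have "f summable_on (?U \<union> (G i - ?U))"
    using insert summable_on_subset_banach[of f "G i" "G i - ?U"]
    by (intro summable_on_Un_disjoint) auto
  also have "?U \<union> (G i - ?U) = (\<Union>i\<in>insert i J. G i)" by auto
  finally show ?case .
qed simp

lemma sum_UN_le:
  fixes f :: "'a \<Rightarrow> real"
  assumes "finite J" "\<And>i. i \<in> J \<Longrightarrow> finite (G i)" "\<And>x. 0 \<le> f x"
  shows "sum f (\<Union>i\<in>J. G i) \<le> (\<Sum>i\<in>J. sum f (G i))"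
  using assms(1,2)
proof (induction J rule: finite_induct)
  case (insert i J)
  have "sum f (G i \<union> (\<Union>i\<in>J. G i)) \<le> sum f (G i) + sum f (\<Union>i\<in>J. G i)"
    using sum.union_inter[of "G i" "\<Union>i\<in>J. G i" f] insert assms(3)
      sum_nonneg[of "G i \<inter> (\<Union>i\<in>J. G i)" f] by simp
  then show ?case using insert by simp
qed simp

text \<open>If all gaps avoided \<open>[\<delta>, \<epsilon>]\<close>, each colour would put the remaining primes of
  \<open>[exp (\<epsilon> * k), exp (\<epsilon> * (k + 1)))\<close> into one interval of logarithmic length \<open>\<delta>\<close>; for small
  \<open>\<delta>\<close> these intervals carry too little of the divergent sum of \<open>1 / p\<close>. Note that \<open>\<delta>\<close>
  does not depend on \<open>E\<close>.\<close>
lemma monochromatic_primes_moderate_gap: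
  fixes a :: "nat \<Rightarrow> 'c" and \<epsilon> :: real
  assumes fin: "finite (a ` {p. prime p})" and \<epsilon>: "0 < \<epsilon>"
  shows "\<exists>\<delta>>0. \<delta> \<le> \<epsilon> \<and> (\<forall>E. (\<lambda>p. 1 / real p) summable_on E \<longrightarrow>
    (\<exists>p q. prime p \<and> prime q \<and> p \<notin> E \<and> q \<notin> E \<and> a p = a q \<and>
       \<delta> \<le> ln (real q) - ln (real p) \<and> ln (real q) - ln (real p) \<le> \<epsilon>))"
proof -
  define A where "A = a ` {p. prime p}"
  have finA: "finite A" using fin by (simp add: A_def)
  define m where "m = card A"
  have "A \<noteq> {}" using two_is_prime_nat by (auto simp: A_def)
  then have m: "1 \<le> real m" using fin by (simp add: m_def A_def card_gt_0_iff Suc_le_eq)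
  \<comment> \<open>With \<open>m\<close> colours, window \<open>k\<close> contributes at most
    \<open>m * \<kappa> / (\<epsilon> * k) = 1 / (2 * k)\<close>. The windows up to \<open>K\<close>
    then give about \<open>ln K / 2\<close>, while the divergence of the sum of \<open>1 / p\<close>
    forces about \<open>ln K\<close>.\<close>
  define \<kappa> where "\<kappa> = \<epsilon> / (2 * real m)"
  have \<kappa>: "0 < \<kappa>" using \<epsilon> m by (simp add: \<kappa>_def)
  obtain \<delta>0 y0 where \<delta>0: "0 < \<delta>0"
    and y0: "\<And>y. y \<ge> y0 \<Longrightarrow> (\<Sum>p | prime p \<and> y \<le> p \<and> real p \<le> real y * exp \<delta>0. 1 / real p) \<le> \<kappa> / ln (real y)"
    using sum_inverse_primes_short_interval[OF \<kappa>] by blast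
  define \<delta> where "\<delta> = min \<delta>0 \<epsilon>"
  have "\<exists>p q. prime p \<and> prime q \<and> p \<notin> E \<and> q \<notin> E \<and> a p = a q \<and>
       \<delta> \<le> ln (real q) - ln (real p) \<and> ln (real q) - ln (real p) \<le> \<epsilon>"
    if E: "(\<lambda>p. 1 / real p) summable_on E" for E
  proof (rule ccontr)
    assume neg: "\<not> ?thesis"
    define B where "B = infsum (\<lambda>p. 1 / real p) E"
    define S where "S k c = {p. prime p \<and> p \<notin> E \<and> a p = c \<and> exp (\<epsilon> * real k) \<le> real p \<and> real p < exp (\<epsilon> * real (Suc k))}" for k c
    have finS: "finite (S k c)" for k c
    proof (rule finite_subset)
      show "S k c \<subseteq> {..nat \<lceil>exp (\<epsilon> * real (Suc k))\<rceil>}"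
        unfolding S_def by (auto simp: nat_le_iff le_nat_iff) linarith
    qed simp
    have sum_S: "(\<Sum>p\<in>S k c. 1 / real p) \<le> \<kappa> / (\<epsilon> * real k)" if k: "k \<ge> 1" "real y0 \<le> exp (\<epsilon> * real k)" for k c
    proof (cases "S k c = {}")
      case True
      then show ?thesis using \<kappa> \<epsilon> by simp
    next
      case False
      \<comment> \<open>Comparing every element with the least one is enough: their gap is at most
        \<epsilon> by the length of the window, hence below \<delta> by the assumption
        \<open>neg\<close>.\<close>
      define y where "y = Min (S k c)"
      have yS: "y \<in> S k c" using False finS by (simp add: y_def)
      have y: "0 < y" "prime y" using yS by (auto simp: S_def prime_gt_0_nat)
      have ly: "\<epsilon> * real k \<le> ln (real y)"
        using yS y by (subst ln_ge_iff) (auto simp: S_def)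
      have sub: "S k c \<subseteq> {p. prime p \<and> y \<le> p \<and> real p \<le> real y * exp \<delta>0}"
      proof
        fix p assume p: "p \<in> S k c"
        then have p0: "0 < p" "prime p" by (auto simp: S_def prime_gt_0_nat)
        have yp: "y \<le> p" unfolding y_def using p finS by simp
        have "ln (real p) < \<epsilon> * real (Suc k)"
          using p p0 by (subst exp_less_cancel_iff[symmetric]) (simp add: S_def)
        then have "ln (real p) - ln (real y) \<le> \<epsilon>"
          using ly by (simp add: algebra_simps)
        moreover have "prime p" "p \<notin> E" "a p = c" "prime y" "y \<notin> E" "a y = c"
          using p yS by (auto simp: S_def)
        ultimately have "\<not> \<delta> \<le> ln (real p) - ln (real y)"
          using neg by metis
        then have "ln (real p) - ln (real y) < \<delta>" by simp
        then have "ln (real p) \<le> ln (real y * exp \<delta>0)"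
          using y by (simp add: ln_mult \<delta>_def)
        then have "real p \<le> real y * exp \<delta>0"
          using p0 y by (subst (asm) ln_le_cancel_iff) auto
        with yp p0 show "p \<in> {p. prime p \<and> y \<le> p \<and> real p \<le> real y * exp \<delta>0}" by simp
      qed
      have "finite {p. prime p \<and> y \<le> p \<and> real p \<le> real y * exp \<delta>0}"
        by (rule finite_subset[of _ "{..nat \<lceil>real y * exp \<delta>0\<rceil>}"]) (auto simp: le_nat_iff, linarith)
      then have "(\<Sum>p\<in>S k c. 1 / real p) \<le> (\<Sum>p | prime p \<and> y \<le> p \<and> real p \<le> real y * exp \<delta>0. 1 / real p)"
        using sub by (intro sum_mono2) auto
      also have "\<dots> \<le> \<kappa> / ln (real y)"
      proof (rule y0)
        have "real y0 \<le> real y" using k yS by (auto simp: S_def)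
        then show "y0 \<le> y" by simp
      qed
      also have "\<dots> \<le> \<kappa> / (\<epsilon> * real k)"
      proof -
        have "0 < \<epsilon> * real k" using k \<epsilon> by simp
        then show ?thesis using ly \<kappa> by (intro divide_left_mono) auto
      qed
      finally show ?thesis .
    qed
    obtain k0 where k0: "k0 \<ge> 1" "real y0 \<le> exp (\<epsilon> * real k0)"
    proof -
      have "real y0 \<le> exp (\<epsilon> * real (max 1 (nat \<lceil>real y0 / \<epsilon>\<rceil>)))"
      proof -
        have "real y0 / \<epsilon> \<le> real (max 1 (nat \<lceil>real y0 / \<epsilon>\<rceil>))" by linarith
        then have "real y0 \<le> \<epsilon> * real (max 1 (nat \<lceil>real y0 / \<epsilon>\<rceil>))"
          using \<epsilon> by (simp add: field_simps)
        also have "\<dots> \<le> exp (\<epsilon> * real (max 1 (nat \<lceil>real y0 / \<epsilon>\<rceil>)))"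
          using exp_ge_add_one_self[of "\<epsilon> * real (max 1 (nat \<lceil>real y0 / \<epsilon>\<rceil>))"] by linarith
        finally show ?thesis .
      qed
      then show ?thesis using that by (metis max.cobounded1)
    qed
    define C0 where "C0 = (\<Sum>p | prime p \<and> real p \<le> exp (\<epsilon> * real k0). 1 / real p)"
    \<comment> \<open>The primes up to \<open>N\<close>, about \<open>exp (\<epsilon> * K)\<close>,
      are small, or in \<open>E\<close>, or in a window. The first two kinds contribute at most
      \<open>C0 + B\<close>, so exponentiating turns \<open>ln K / 2\<close> into
      \<open>sqrt K\<close>. As \<open>ln N\<close> is about \<open>\<epsilon> * K\<close>, this
      fails for large \<open>K\<close>.\<close>
    have bound: "\<epsilon> * real K \<le> 2 * exp (C0 + B + 1 / 2) * sqrt (real K)" if K: "K \<ge> k0" for K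
    proof -
      define N where "N = nat \<lfloor>exp (\<epsilon> * real K)\<rfloor>"
      have N: "real N \<le> exp (\<epsilon> * real K)" "exp (\<epsilon> * real K) < real N + 1"
        unfolding N_def by (simp, linarith)
      let ?P = "{p. prime p \<and> p \<le> N}"
      let ?X = "{p. prime p \<and> real p \<le> exp (\<epsilon> * real k0)}"
      let ?Y = "?P \<inter> E"
      let ?Z = "\<Union>k\<in>{k0..K}. \<Union>c\<in>A. S k c"
      have finX: "finite ?X"
        by (rule finite_subset[of _ "{..nat \<lceil>exp (\<epsilon> * real k0)\<rceil>}"]) (auto simp: le_nat_iff, linarith)
      have finZ: "finite ?Z" using finA finS by auto
      have cover: "?P \<subseteq> ?X \<union> ?Y \<union> ?Z"
      proof
        fix p assume p: "p \<in> ?P"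
        show "p \<in> ?X \<union> ?Y \<union> ?Z"
        proof (cases "p \<in> ?X \<or> p \<in> E")
          case True
          then show ?thesis using p by auto
        next
          case False
          have p0: "0 < real p" using p by (auto simp: prime_gt_0_nat)
          define k where "k = nat \<lfloor>ln (real p) / \<epsilon>\<rfloor>"
          have "\<epsilon> * real k0 < ln (real p)" using False p p0 by (subst exp_less_cancel_iff[symmetric]) (auto simp: not_le)
          then have kk: "real k0 < ln (real p) / \<epsilon>" using \<epsilon> by (simp add: field_simps)
          then have "real k \<le> ln (real p) / \<epsilon>" "ln (real p) / \<epsilon> < real (Suc k)"
            by (auto simp: k_def) linarith+
          then have k: "\<epsilon> * real k \<le> ln (real p)" "ln (real p) < \<epsilon> * real (Suc k)"
            using \<epsilon> by (simp_all add: field_simps)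
          have "exp (\<epsilon> * real k) \<le> exp (ln (real p))" "exp (ln (real p)) < exp (\<epsilon> * real (Suc k))"
            using k by (simp_all only: exp_le_cancel_iff exp_less_cancel_iff)
          then have "exp (\<epsilon> * real k) \<le> real p" "real p < exp (\<epsilon> * real (Suc k))"
            using p0 by simp_all
          then have pS: "p \<in> S k (a p)" using p False by (simp add: S_def)
          have "k0 \<le> k" using kk by (simp add: k_def le_nat_iff le_floor_iff)
          moreover have "k \<le> K"
          proof -
            have "real p \<le> exp (\<epsilon> * real K)" using p N by auto
            with \<open>exp (\<epsilon> * real k) \<le> real p\<close> have "\<epsilon> * real k \<le> \<epsilon> * real K"
              using exp_le_cancel_iff order_trans by blast
            then show ?thesis using \<epsilon> by simp
          qed
          ultimately show ?thesis using pS p by (auto simp: A_def)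
        qed
      qed
      have "(\<Sum>p\<in>?P. 1 / real p) \<le> (\<Sum>p\<in>?X \<union> ?Y \<union> ?Z. 1 / real p)"
        using finX finZ cover by (intro sum_mono2) auto
      also have "\<dots> \<le> (\<Sum>p\<in>?X. 1 / real p) + (\<Sum>p\<in>?Y. 1 / real p) + (\<Sum>p\<in>?Z. 1 / real p)"
      proof -
        have Un: "(\<Sum>p\<in>U \<union> V. 1 / real p) \<le> (\<Sum>p\<in>U. 1 / real p) + (\<Sum>p\<in>V. 1 / real p)"
          if "finite U" "finite V" for U V
          using sum.union_inter[OF that, of "\<lambda>p. 1 / real p"] sum_nonneg[of "U \<inter> V" "\<lambda>p. 1 / real p"] by simp
        show ?thesis
          using Un[of "?X \<union> ?Y" ?Z] Un[of ?X ?Y] finX finZ by simp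
      qed
      also have "(\<Sum>p\<in>?X. 1 / real p) = C0" by (simp add: C0_def)
      also have "(\<Sum>p\<in>?Y. 1 / real p) \<le> B"
        unfolding B_def using E by (intro finite_sum_le_infsum) auto
      also have "(\<Sum>p\<in>?Z. 1 / real p) \<le> (\<Sum>k=k0..K. \<Sum>c\<in>A. \<Sum>p\<in>S k c. 1 / real p)"
      proof -
        have "(\<Sum>p\<in>?Z. 1 / real p) \<le> (\<Sum>k=k0..K. \<Sum>p\<in>(\<Union>c\<in>A. S k c). 1 / real p)"
          using finA finS by (intro sum_UN_le) auto
        also have "\<dots> \<le> (\<Sum>k=k0..K. \<Sum>c\<in>A. \<Sum>p\<in>S k c. 1 / real p)"
          using finA finS by (intro sum_mono sum_UN_le) auto
        finally show ?thesis .
      qed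
      also have "\<dots> \<le> (\<Sum>k=k0..K. \<Sum>c\<in>A. \<kappa> / (\<epsilon> * real k))"
      proof (intro sum_mono sum_S)
        fix k assume k: "k \<in> {k0..K}"
        then show "k \<ge> 1" using k0 by simp
        have "\<epsilon> * real k0 \<le> \<epsilon> * real k" using k \<epsilon> by simp
        then show "real y0 \<le> exp (\<epsilon> * real k)" using k0(2) exp_le_cancel_iff order_trans by blast
      qed
      also have "\<dots> = (1 / 2) * (\<Sum>k=k0..K. 1 / real k)"
        using m \<epsilon> by (simp add: sum_distrib_left m_def[symmetric] \<kappa>_def field_simps)
      also have "(\<Sum>k=k0..K. 1 / real k) \<le> (\<Sum>k=1..K. 1 / real k)"
        using k0 by (intro sum_mono2) auto
      also have "(\<Sum>k=1..K. 1 / real k) \<le> 1 + ln (real K)"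
        using euler_mascheroni_sequence_decreasing[of 1 K] K k0 by (simp add: harm_def inverse_eq_divide)
      finally have "(\<Sum>p\<in>?P. 1 / real p) \<le> C0 + B + 1 / 2 + ln (real K) / 2"
        by (simp add: add_divide_distrib)
      then have "exp (\<Sum>p\<in>?P. 1 / real p) \<le> exp (C0 + B + 1 / 2) * exp (ln (real K) / 2)"
        by (simp flip: exp_add)
      also have "exp (ln (real K) / 2) = sqrt (real K)"
        using K k0 by (simp add: ln_sqrt[symmetric])
      finally have "ln (real N + 1) \<le> 2 * (exp (C0 + B + 1 / 2) * sqrt (real K))"
        using ln_le_exp_sum_inverse_primes[of N] by linarith
      moreover have "\<epsilon> * real K \<le> ln (real N + 1)"
        using N by (subst ln_ge_iff) auto
      ultimately show ?thesis by simp
    qed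
    define D where "D = 2 * exp (C0 + B + 1 / 2)"
    obtain K where K: "max (real k0) ((D / \<epsilon>)\<^sup>2) < real K"
      using reals_Archimedean2 by blast
    then have "k0 \<le> K" "(D / \<epsilon>)\<^sup>2 < real K" by auto
    have "D / \<epsilon> < sqrt (real K)"
      using \<open>(D / \<epsilon>)\<^sup>2 < real K\<close> real_less_rsqrt by blast
    then have "D < \<epsilon> * sqrt (real K)" using \<epsilon> by (simp add: field_simps)
    moreover have "0 < sqrt (real K)" using K by (auto intro: le_less_trans)
    ultimately have "D * sqrt (real K) < \<epsilon> * sqrt (real K) * sqrt (real K)"
      by (rule mult_strict_right_mono)
    then have "D * sqrt (real K) < \<epsilon> * real K" by (simp add: mult.assoc)
    with bound[OF \<open>k0 \<le> K\<close>] show False unfolding D_def by simp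
  qed
  moreover have "\<delta> > 0" "\<delta> \<le> \<epsilon>" using \<delta>0 \<epsilon> by (auto simp: \<delta>_def)
  ultimately show ?thesis by blast
qed

section \<open>Cesaro means and the Turan--Kubilius inequality\<close>

text \<open>An ultrafilter would do; Tychonoff's theorem supplies what is needed directly.
  Evaluating all bounded sequences at \<open>n\<close> gives a point of a product of compact
  intervals, and \<open>F\<close> is refined so that these points converge to one of their cluster
  points.\<close>

lemma exists_universal_filter:
  fixes F :: "'n filter"
  assumes "F \<noteq> bot"
  shows "\<exists>G\<le>F. G \<noteq> bot \<and> (\<forall>h :: 'n \<Rightarrow> real. bounded (range h) \<longrightarrow> (\<exists>l. (h \<longlongrightarrow> l) G))"
proof -
  define B where "B h = (SUP n. \<bar>h n\<bar>)" for h :: "'n \<Rightarrow> real"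
  \<comment> \<open>Unbounded \<open>h\<close> are sent to 0, so that every coordinate stays in a
    compact set.\<close>
  define \<Phi> where "\<Phi> n h = (if bounded (range h) then h n else 0)" for n and h :: "'n \<Rightarrow> real"
  define K where "K = PiE UNIV (\<lambda>h :: 'n \<Rightarrow> real. if bounded (range h) then {- B h..B h} else {0})"
  have "compactin (product_topology (\<lambda>_. euclidean) UNIV) K"
    unfolding K_def compactin_PiE by simp
  then have K: "compact K"
    by (simp add: euclidean_product_topology)
  have "\<Phi> n \<in> K" for n
  proof -
    have "\<bar>h n\<bar> \<le> B h" if "bounded (range h)" for h
      unfolding B_def using that
      by (intro cSUP_upper bounded_imp_bdd_above) (auto simp: bounded_iff)
    then show ?thesis by (fastforce simp: K_def \<Phi>_def abs_le_iff)
  qed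
  then have "\<forall>\<^sub>F x in filtermap \<Phi> F. x \<in> K" by (simp add: eventually_filtermap)
  moreover have "filtermap \<Phi> F \<noteq> bot" using assms by (simp add: filtermap_bot_iff)
  ultimately obtain l where l: "inf (nhds l) (filtermap \<Phi> F) \<noteq> bot"
    using K unfolding compact_filter by blast
  define G where "G = inf F (filtercomap \<Phi> (nhds l))"
  have "G \<noteq> bot"
  proof
    assume "G = bot"
    then obtain P Q where PQ: "eventually P F" "eventually Q (nhds l)" "\<And>n. P n \<Longrightarrow> Q (\<Phi> n) \<Longrightarrow> False"
      unfolding G_def trivial_limit_def eventually_inf eventually_filtercomap by auto
    then have "eventually (\<lambda>x. \<exists>n. P n \<and> x = \<Phi> n) (filtermap \<Phi> F)"
      unfolding eventually_filtermap by (auto elim: eventually_mono)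
    with PQ(2) have "eventually (\<lambda>_. False) (inf (nhds l) (filtermap \<Phi> F))"
      unfolding eventually_inf using PQ(3) by blast
    with l show False by (simp add: trivial_limit_def)
  qed
  moreover have "G \<le> F" by (simp add: G_def)
  moreover have "(h \<longlongrightarrow> l h) G" if h: "bounded (range h)" for h
  proof -
    have "filterlim \<Phi> (nhds l) G"
      unfolding G_def by (rule filterlim_mono[OF filterlim_filtercomap]) auto
    have "((\<lambda>n. \<Phi> n h) \<longlongrightarrow> l h) G"
    proof (rule topological_tendstoI)
      fix S :: "real set" assume S: "open S" "l h \<in> S"
      have "open ((\<lambda>x. x h) -` S :: (('n \<Rightarrow> real) \<Rightarrow> real) set)"
        using S(1) continuous_on_product_coordinates by (rule open_vimage)
      from topological_tendstoD[OF \<open>filterlim \<Phi> (nhds l) G\<close> this]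
      show "\<forall>\<^sub>F n in G. \<Phi> n h \<in> S" using S(2) by simp
    qed
    then show ?thesis using h by (simp add: \<Phi>_def)
  qed
  ultimately show ?thesis by blast
qed

section \<open>Cesaro means and densities of sets of multiples\<close>

definition cmean :: "(nat \<Rightarrow> real) \<Rightarrow> nat \<Rightarrow> real" where
  "cmean \<phi> N = (\<Sum>n=1..N. \<phi> n) / real N"

lemma abs_cmean_le: "(\<And>n. \<bar>\<phi> n\<bar> \<le> B) \<Longrightarrow> \<bar>cmean \<phi> N\<bar> \<le> B"
proof (cases "N = 0")
  case False
  assume B: "\<And>n. \<bar>\<phi> n\<bar> \<le> B"
  have "\<bar>\<Sum>n=1..N. \<phi> n\<bar> \<le> (\<Sum>n=1..N. B)"
    using B by (intro order_trans[OF sum_abs] sum_mono) auto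
  with False show ?thesis by (simp add: cmean_def field_simps)
qed (use order_trans[OF abs_ge_zero] in \<open>auto simp: cmean_def\<close>)

text \<open>One \<open>B\<close> pays for the additional terms, the other for the change of
  normalisation. With \<open>M\<close> and \<open>M'\<close> two dilations of the same
  \<open>N\<close>, the bound depends in the limit on their ratio only.\<close>

lemma cmean_diff_le:
  assumes B: "\<And>n. \<bar>\<phi> n\<bar> \<le> B" and M: "M \<le> M'" "0 < M"
  shows "\<bar>cmean \<phi> M - cmean \<phi> M'\<bar> \<le> 2 * B * (1 - real M / real M')"
proof -
  have B0: "0 \<le> B" using B[of 0] by linarith
  define S where "S = (\<Sum>n=1..M. \<phi> n)"
  define R where "R = (\<Sum>n=Suc M..M'. \<phi> n)"
  have split: "(\<Sum>n=1..M'. \<phi> n) = S + R"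
    unfolding S_def R_def using sum.ub_add_nat[of 1 M \<phi> "M' - M"] M by simp
  have R: "\<bar>R\<bar> \<le> B * (real M' - real M)"
  proof -
    have "\<bar>R\<bar> \<le> (\<Sum>n=Suc M..M'. B)"
      unfolding R_def using B by (intro order_trans[OF sum_abs] sum_mono) auto
    then show ?thesis using M by (simp add: of_nat_diff mult.commute)
  qed
  have S: "\<bar>S / real M\<bar> \<le> B"
    using abs_cmean_le[of \<phi> B M] B by (simp add: S_def cmean_def)
  have "cmean \<phi> M - cmean \<phi> M' = S / real M * (1 - real M / real M') - R / real M'"
  proof -
    have "cmean \<phi> M = S / real M" "cmean \<phi> M' = (S + R) / real M'"
      by (simp_all only: cmean_def split S_def)
    then show ?thesis using M by (simp add: field_simps)
  qed
  also have "\<bar>\<dots>\<bar> \<le> B * (1 - real M / real M') + B * (1 - real M / real M')"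
  proof (rule order_trans[OF abs_triangle_ineq4], intro add_mono)
    show "\<bar>S / real M * (1 - real M / real M')\<bar> \<le> B * (1 - real M / real M')"
      unfolding abs_mult using S M B0 by (intro mult_mono) auto
    show "\<bar>R / real M'\<bar> \<le> B * (1 - real M / real M')"
      using R M by (simp add: field_simps)
  qed
  finally show ?thesis by simp
qed

lemma multiples_eq_image: "d > 0 \<Longrightarrow> {n \<in> {1..N}. d dvd n} = (\<lambda>m. d * m) ` {1..N div d}" for d :: nat
  by (auto simp: dvd_def less_eq_div_iff_mult_less_eq mult.commute image_iff Suc_le_eq)

lemma inj_on_mult_nat: "d > 0 \<Longrightarrow> inj_on (\<lambda>m. d * m) A" for d :: nat
  by (simp add: inj_on_def)

lemma card_multiples: "d > 0 \<Longrightarrow> card {n \<in> {1..N}. d dvd n} = N div d"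
  by (simp only: multiples_eq_image card_image[OF inj_on_mult_nat]) simp

lemma tendsto_div_ratio:
  "d > 0 \<Longrightarrow> (\<lambda>N. real (N div d) / real N) \<longlonglongrightarrow> 1 / real d"
proof (rule tendsto_sandwich[of "\<lambda>N. 1 / real d - 1 / real N" _ _ "\<lambda>N. 1 / real d"])
  assume d: "d > 0"
  have *: "real (N div d) \<le> real N / real d" "real N / real d - 1 \<le> real (N div d)" for N
  proof -
    have "real (N div d) = of_int \<lfloor>real N / real d\<rfloor>" by (simp add: floor_divide_of_nat_eq)
    then show "real (N div d) \<le> real N / real d" "real N / real d - 1 \<le> real (N div d)" by linarith+
  qed
  show "\<forall>\<^sub>F N in sequentially. 1 / real d - 1 / real N \<le> real (N div d) / real N"
    using eventually_gt_at_top[of 0]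
  proof eventually_elim
    case (elim N)
    have "1 / real d - 1 / real N = (real N / real d - 1) / real N"
      using elim by (simp add: diff_divide_distrib)
    also have "\<dots> \<le> real (N div d) / real N" using *(2) by (intro divide_right_mono) auto
    finally show ?case .
  qed
  show "\<forall>\<^sub>F N in sequentially. real (N div d) / real N \<le> 1 / real d"
    using eventually_gt_at_top[of 0]
  proof eventually_elim
    case (elim N)
    have "real (N div d) / real N \<le> (real N / real d) / real N" using *(1) by (intro divide_right_mono) auto
    with elim show ?case by simp
  qed
  show "(\<lambda>N. 1 / real d - 1 / real N) \<longlonglongrightarrow> 1 / real d"
    using tendsto_diff[OF tendsto_const lim_1_over_n[where 'a=real], of "1 / real d"] by simp
qed simp

abbreviation dvd_ind :: "nat \<Rightarrow> nat \<Rightarrow> real" where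
  "dvd_ind d n \<equiv> of_bool (d dvd n)"

lemma cmean_dvd_ind: "d > 0 \<Longrightarrow> cmean (dvd_ind d) N = real (N div d) / real N"
  unfolding cmean_def using card_multiples[of d N] by (simp add: Int_def conj_commute)

lemma cmean_add: "cmean (\<lambda>n. \<phi> n + \<psi> n) N = cmean \<phi> N + cmean \<psi> N"
  by (simp add: cmean_def sum.distrib add_divide_distrib)

lemma cmean_diff: "cmean (\<lambda>n. \<phi> n - \<psi> n) N = cmean \<phi> N - cmean \<psi> N"
  by (simp add: cmean_def sum_subtractf diff_divide_distrib)

lemma cmean_cmult: "cmean (\<lambda>n. c * \<phi> n) N = c * cmean \<phi> N"
  by (simp add: cmean_def sum_distrib_left)

lemma cmean_sum: "cmean (\<lambda>n. \<Sum>p\<in>F. \<phi> p n) N = (\<Sum>p\<in>F. cmean (\<phi> p) N)"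
  unfolding cmean_def by (subst sum.swap) (simp add: sum_divide_distrib)

lemma cmean_const: "N > 0 \<Longrightarrow> cmean (\<lambda>_. c) N = c"
  by (simp add: cmean_def)

text \<open>Divisibility by distinct primes is asymptotically independent, since their common
  multiples are the multiples of the product; the diagonal value is the variance of a Bernoulli
  variable with mean \<open>1 / p\<close>.\<close>

lemma cmean_tendsto_covariance:
  assumes p: "prime p" and q: "prime q"
  shows "(\<lambda>N. cmean (\<lambda>n. (dvd_ind p n - 1 / real p) * (dvd_ind q n - 1 / real q)) N)
    \<longlonglongrightarrow> (if p = q then 1 / real p - 1 / (real p)\<^sup>2 else 0)"
proof -
  define r where "r = (if p = q then p else p * q)"
  have pos: "p > 0" "q > 0" "r > 0" using p q by (auto simp: r_def prime_gt_0_nat)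
  have ind: "dvd_ind p n * dvd_ind q n = dvd_ind r n" for n
    using p q primes_coprime[of p q] by (auto simp: r_def divides_mult intro: dvd_mult_left dvd_mult_right)
  have "(\<lambda>N. cmean (dvd_ind r) N - 1 / real q * cmean (dvd_ind p) N
        - 1 / real p * cmean (dvd_ind q) N + 1 / (real p * real q))
     \<longlonglongrightarrow> 1 / real r - 1 / real q * (1 / real p) - 1 / real p * (1 / real q) + 1 / (real p * real q)"
    unfolding cmean_dvd_ind[OF pos(1)] cmean_dvd_ind[OF pos(2)] cmean_dvd_ind[OF pos(3)]
    using pos by (intro tendsto_intros tendsto_div_ratio)
  also have "1 / real r - 1 / real q * (1 / real p) - 1 / real p * (1 / real q) + 1 / (real p * real q)
    = (if p = q then 1 / real p - 1 / (real p)\<^sup>2 else 0)"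
    by (simp add: r_def power2_eq_square)
  finally show ?thesis
  proof (rule Lim_transform_eventually)
    show "\<forall>\<^sub>F N in sequentially. cmean (dvd_ind r) N - 1 / real q * cmean (dvd_ind p) N
        - 1 / real p * cmean (dvd_ind q) N + 1 / (real p * real q)
        = cmean (\<lambda>n. (dvd_ind p n - 1 / real p) * (dvd_ind q n - 1 / real q)) N"
      using eventually_gt_at_top[of 0]
    proof eventually_elim
      case (elim N)
      have "(dvd_ind p n - 1 / real p) * (dvd_ind q n - 1 / real q) =
        dvd_ind r n - 1 / real q * dvd_ind p n - 1 / real p * dvd_ind q n + 1 / (real p * real q)" for n
        unfolding ind[symmetric] by (simp add: algebra_simps)
      then show ?case
        using elim by (simp only: cmean_add cmean_diff cmean_cmult cmean_const)
    qed
  qed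
qed

lemma cmean_Cauchy_Schwarz:
  assumes "\<And>n. \<bar>\<phi> n\<bar> \<le> B"
  shows "\<bar>cmean (\<lambda>n. \<phi> n * \<psi> n) N\<bar> \<le> B * sqrt (cmean (\<lambda>n. (\<psi> n)\<^sup>2) N)"
proof (cases "N = 0")
  case False
  have B0: "0 \<le> B" using assms[of 0] by linarith
  have "(cmean (\<lambda>n. \<phi> n * \<psi> n) N)\<^sup>2 \<le> cmean (\<lambda>n. (\<phi> n)\<^sup>2) N * cmean (\<lambda>n. (\<psi> n)\<^sup>2) N"
    using Cauchy_Schwarz_ineq_sum[of \<phi> \<psi> "{1..N}"] False
    by (simp add: cmean_def power_divide power2_eq_square divide_right_mono)
  also have "\<dots> \<le> B\<^sup>2 * cmean (\<lambda>n. (\<psi> n)\<^sup>2) N"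
  proof (intro mult_right_mono)
    have "\<bar>(\<phi> n)\<^sup>2\<bar> \<le> B\<^sup>2" for n
      using power_mono[OF assms[of n], of 2] by simp
    from abs_cmean_le[OF this] show "cmean (\<lambda>n. (\<phi> n)\<^sup>2) N \<le> B\<^sup>2" by (rule abs_le_D1)
    show "0 \<le> cmean (\<lambda>n. (\<psi> n)\<^sup>2) N" by (simp add: cmean_def sum_nonneg)
  qed
  finally have "\<bar>cmean (\<lambda>n. \<phi> n * \<psi> n) N\<bar> \<le> sqrt (B\<^sup>2 * cmean (\<lambda>n. (\<psi> n)\<^sup>2) N)"
    by (intro real_le_rsqrt) simp
  then show ?thesis using B0 by (simp add: real_sqrt_mult)
qed (simp add: cmean_def)

lemma cmean_mult_dvd_ind:
  assumes "d > 0"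
  shows "cmean (\<lambda>n. \<phi> n * dvd_ind d n) N = real (N div d) / real N * cmean (\<lambda>m. \<phi> (d * m)) (N div d)"
proof -
  have "(\<Sum>n=1..N. \<phi> n * dvd_ind d n) = (\<Sum>n\<in>{n\<in>{1..N}. d dvd n}. \<phi> n)"
    by (intro sum.mono_neutral_cong_right) auto
  also have "\<dots> = (\<Sum>m=1..N div d. \<phi> (d * m))"
    using assms by (simp only: multiples_eq_image sum.reindex[OF inj_on_mult_nat] o_def)
  finally show ?thesis by (simp add: cmean_def)
qed

text \<open>Dual to the Turan--Kubilius inequality: apply Cauchy--Schwarz to \<open>\<phi>\<close> and the centred
  count of the prime divisors of \<open>n\<close> in \<open>F\<close>. The last term absorbs the multiples of \<open>p\<^sup>2\<close>,
  on which \<open>\<phi> (p * n)\<close> is uncontrolled.\<close>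
lemma turan_kubilius_dual:
  assumes F: "finite F" "\<And>p. p \<in> F \<Longrightarrow> prime p"
    and \<phi>: "\<And>n. \<bar>\<phi> n\<bar> \<le> B" and \<psi>: "\<And>p n. \<bar>\<psi> p n\<bar> \<le> B"
    and eq: "\<And>p n. p \<in> F \<Longrightarrow> n > 0 \<Longrightarrow> \<not> p dvd n \<Longrightarrow> \<phi> (p * n) = \<psi> p n"
    and G: "G \<noteq> bot" and M: "filterlim M at_top G"
    and u: "((\<lambda>i. cmean \<phi> (M i)) \<longlongrightarrow> u) G"
    and v: "\<And>p. p \<in> F \<Longrightarrow> ((\<lambda>i. cmean (\<psi> p) (M i div p)) \<longlongrightarrow> v p) G"
  shows "\<bar>\<Sum>p\<in>F. 1 / real p * (v p - u)\<bar> \<le> B * sqrt (\<Sum>p\<in>F. 1 / real p) + 2 * B * (\<Sum>p\<in>F. 1 / (real p)\<^sup>2)"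
proof -
  have B0: "0 \<le> B" using \<phi>[of 0] by linarith
  define D where "D n = (\<Sum>p\<in>F. dvd_ind p n - 1 / real p)" for n
  have pos: "p > 0" if "p \<in> F" for p using F(2)[OF that] by (simp add: prime_gt_0_nat)
  \<comment> \<open>Only the diagonal covariances survive, so the variance grows like the sum of
    \<open>1 / p\<close> and not like its square.\<close>
  have varN: "(\<lambda>N. cmean (\<lambda>n. (D n)\<^sup>2) N) \<longlonglongrightarrow> (\<Sum>p\<in>F. 1 / real p - 1 / (real p)\<^sup>2)"
  proof -
    have "(D n)\<^sup>2 = (\<Sum>p\<in>F. \<Sum>q\<in>F. (dvd_ind p n - 1 / real p) * (dvd_ind q n - 1 / real q))" for n
      by (simp add: D_def power2_eq_square sum_product)
    moreover have "(\<lambda>N. \<Sum>p\<in>F. \<Sum>q\<in>F. cmean (\<lambda>n. (dvd_ind p n - 1 / real p) * (dvd_ind q n - 1 / real q)) N)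
      \<longlonglongrightarrow> (\<Sum>p\<in>F. \<Sum>q\<in>F. if p = q then 1 / real p - 1 / (real p)\<^sup>2 else 0)"
      using F(2) by (intro tendsto_sum cmean_tendsto_covariance)
    ultimately show ?thesis using F(1) by (simp add: cmean_sum)
  qed
  have main: "\<bar>\<Sum>p\<in>F. real (N div p) / real N * cmean (\<psi> p) (N div p) - 1 / real p * cmean \<phi> N\<bar>
    \<le> B * sqrt (cmean (\<lambda>n. (D n)\<^sup>2) N) + (\<Sum>p\<in>F. real (N div p) / real N * (2 * B * cmean (dvd_ind p) (N div p)))" for N
  proof -
    have "cmean (\<lambda>n. \<phi> n * D n) N = (\<Sum>p\<in>F. real (N div p) / real N * cmean (\<lambda>m. \<phi> (p * m)) (N div p) - 1 / real p * cmean \<phi> N)"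
    proof -
      have "\<phi> n * D n = (\<Sum>p\<in>F. \<phi> n * dvd_ind p n - 1 / real p * \<phi> n)" for n
        by (simp add: D_def sum_distrib_left algebra_simps)
      then show ?thesis
        by (simp only: cmean_sum cmean_diff cmean_cmult)
          (intro sum.cong refl, simp add: cmean_mult_dvd_ind pos)
    qed
    then have decomp: "(\<Sum>p\<in>F. real (N div p) / real N * cmean (\<psi> p) (N div p) - 1 / real p * cmean \<phi> N)
      = cmean (\<lambda>n. \<phi> n * D n) N + (\<Sum>p\<in>F. real (N div p) / real N * (cmean (\<psi> p) (N div p) - cmean (\<lambda>m. \<phi> (p * m)) (N div p)))"
      by (simp add: sum_subtractf algebra_simps)
    show ?thesis
      unfolding decomp
    proof (rule order_trans[OF abs_triangle_ineq], intro add_mono cmean_Cauchy_Schwarz \<phi>)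
      \<comment> \<open>The two sequences agree off the multiples of \<open>p\<close>. Their density
        \<open>1 / p\<close>, multiplied by the weight \<open>1 / p\<close> of the summand, yields
        the term with \<open>1 / p^2\<close> in the limit.\<close>
      have "\<bar>cmean (\<psi> p) K - cmean (\<lambda>m. \<phi> (p * m)) K\<bar> \<le> 2 * B * cmean (dvd_ind p) K" if p: "p \<in> F" for p K
      proof -
        have "\<bar>\<psi> p n - \<phi> (p * n)\<bar> \<le> 2 * B * dvd_ind p n" if "n \<in> {1..K}" for n
          using eq[OF p, of n] that \<phi>[of "p * n"] \<psi>[of p n] by (cases "p dvd n") auto
        then have "\<bar>\<Sum>n=1..K. \<psi> p n - \<phi> (p * n)\<bar> \<le> (\<Sum>n=1..K. 2 * B * dvd_ind p n)"
          by (intro order_trans[OF sum_abs] sum_mono)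
        then have "\<bar>cmean (\<lambda>n. \<psi> p n - \<phi> (p * n)) K\<bar> \<le> cmean (\<lambda>n. 2 * B * dvd_ind p n) K"
          unfolding cmean_def by (simp add: divide_right_mono)
        then show ?thesis by (simp only: cmean_diff cmean_cmult)
      qed
      then show "\<bar>\<Sum>p\<in>F. real (N div p) / real N * (cmean (\<psi> p) (N div p) - cmean (\<lambda>m. \<phi> (p * m)) (N div p))\<bar>
        \<le> (\<Sum>p\<in>F. real (N div p) / real N * (2 * B * cmean (dvd_ind p) (N div p)))"
        by (intro order_trans[OF sum_abs] sum_mono) (simp only: abs_mult abs_of_nonneg mult_left_mono divide_nonneg_nonneg of_nat_0_le_iff)
    qed
  qed
  have ratio: "((\<lambda>i. real (M i div p) / real (M i)) \<longlongrightarrow> 1 / real p) G" if p: "p \<in> F" for p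
    by (rule filterlim_compose[OF tendsto_div_ratio M]) (rule pos[OF p])
  have Mp: "filterlim (\<lambda>i. M i div p) at_top G" if p: "p \<in> F" for p
    by (rule filterlim_compose[OF filterlim_at_top_div_const_nat M]) (rule pos[OF p])
  have dens: "((\<lambda>i. cmean (dvd_ind p) (M i div p)) \<longlongrightarrow> 1 / real p) G" if p: "p \<in> F" for p
    unfolding cmean_dvd_ind[OF pos[OF p]]
    by (rule filterlim_compose[OF tendsto_div_ratio Mp[OF p]]) (rule pos[OF p])
  have lhs: "((\<lambda>i. \<bar>\<Sum>p\<in>F. real (M i div p) / real (M i) * cmean (\<psi> p) (M i div p) - 1 / real p * cmean \<phi> (M i)\<bar>)
      \<longlongrightarrow> \<bar>\<Sum>p\<in>F. 1 / real p * v p - 1 / real p * u\<bar>) G"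
    by (intro tendsto_intros ratio v u)
  have rhs: "((\<lambda>i. B * sqrt (cmean (\<lambda>n. (D n)\<^sup>2) (M i)) + (\<Sum>p\<in>F. real (M i div p) / real (M i) * (2 * B * cmean (dvd_ind p) (M i div p))))
      \<longlongrightarrow> B * sqrt (\<Sum>p\<in>F. 1 / real p - 1 / (real p)\<^sup>2) + (\<Sum>p\<in>F. 1 / real p * (2 * B * (1 / real p)))) G"
    by (intro tendsto_intros ratio dens filterlim_compose[OF varN M])
  have "\<bar>\<Sum>p\<in>F. 1 / real p * (v p - u)\<bar> = \<bar>\<Sum>p\<in>F. 1 / real p * v p - 1 / real p * u\<bar>"
    by (simp only: right_diff_distrib)
  also have "\<dots> \<le> B * sqrt (\<Sum>p\<in>F. 1 / real p - 1 / (real p)\<^sup>2) + (\<Sum>p\<in>F. 1 / real p * (2 * B * (1 / real p)))"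
    by (rule tendsto_le[OF G rhs lhs]) (intro always_eventually allI main)
  also have "(\<Sum>p\<in>F. 1 / real p * (2 * B * (1 / real p))) = 2 * B * (\<Sum>p\<in>F. 1 / (real p)\<^sup>2)"
    by (simp add: sum_distrib_left power2_eq_square)
  also have "B * sqrt (\<Sum>p\<in>F. 1 / real p - 1 / (real p)\<^sup>2) \<le> B * sqrt (\<Sum>p\<in>F. 1 / real p)"
    by (intro mult_left_mono real_sqrt_le_mono sum_mono B0) simp
  finally show ?thesis by simp
qed

section \<open>Limits of orbit averages\<close>

definition dilate :: "real \<Rightarrow> nat \<Rightarrow> nat" where
  "dilate s N = nat \<lfloor>exp s * real N\<rfloor>"

lemma dilate_0: "dilate 0 N = N"
  by (simp add: dilate_def)

text \<open>Nested floors collapse, so the identity is exact. The means over \<open>M div p\<close>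
  produced by the dual inequality are therefore again means at a dilation.\<close>

lemma dilate_div: "p > 0 \<Longrightarrow> dilate s N div p = dilate (s - ln (real p)) N"
proof -
  assume p: "p > 0"
  have "exp (s - ln (real p)) * real N = exp s * real N / real_of_int (int p)"
    using p by (simp add: exp_diff)
  then have "\<lfloor>exp (s - ln (real p)) * real N\<rfloor> = \<lfloor>exp s * real N\<rfloor> div int p"
    using floor_divide_real_eq_div[of "int p" "exp s * real N"] by simp
  then show ?thesis
    unfolding dilate_def by (simp add: nat_div_distrib)
qed

lemma dilate_mono: "s \<le> s' \<Longrightarrow> dilate s N \<le> dilate s' N"
  unfolding dilate_def by (intro nat_mono floor_mono mult_right_mono) auto

lemma dilate_bounds: "exp s * real N - 1 \<le> real (dilate s N)" "real (dilate s N) \<le> exp s * real N"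
proof -
  have "0 \<le> exp s * real N" by simp
  then show "exp s * real N - 1 \<le> real (dilate s N)" "real (dilate s N) \<le> exp s * real N"
    unfolding dilate_def by linarith+
qed

lemma tendsto_dilate: "(\<lambda>N. real (dilate s N) / real N) \<longlonglongrightarrow> exp s"
proof (rule tendsto_sandwich[of "\<lambda>N. exp s - 1 / real N" _ _ "\<lambda>N. exp s"])
  show "\<forall>\<^sub>F N in sequentially. exp s - 1 / real N \<le> real (dilate s N) / real N"
    using eventually_gt_at_top[of 0]
  proof eventually_elim
    case (elim N)
    have "exp s - 1 / real N = (exp s * real N - 1) / real N"
      using elim by (simp add: diff_divide_distrib)
    also have "\<dots> \<le> real (dilate s N) / real N"
      by (intro divide_right_mono dilate_bounds) auto
    finally show ?case .
  qed
  show "\<forall>\<^sub>F N in sequentially. real (dilate s N) / real N \<le> exp s"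
    using eventually_gt_at_top[of 0]
    by eventually_elim (use dilate_bounds in \<open>simp add: divide_le_eq\<close>)
  show "(\<lambda>N. exp s - 1 / real N) \<longlonglongrightarrow> exp s"
    using tendsto_diff[OF tendsto_const lim_1_over_n[where 'a=real], of "exp s"] by simp
qed simp

lemma filterlim_dilate: "filterlim (dilate s) at_top sequentially"
proof -
  have "filterlim (\<lambda>N. exp s * real N) at_top sequentially"
    by (rule filterlim_tendsto_pos_mult_at_top[OF tendsto_const _ filterlim_real_sequentially]) simp
  then have "filterlim (\<lambda>N. - 1 + exp s * real N) at_top sequentially"
    by (rule filterlim_tendsto_add_at_top[OF tendsto_const])
  then have "filterlim (\<lambda>N. exp s * real N - 1) at_top sequentially"
    by simp
  then have "filterlim (\<lambda>N. real (dilate s N)) at_top sequentially"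
    by (rule filterlim_at_top_mono) (intro always_eventually allI dilate_bounds)
  then show ?thesis
    using filterlim_sequentially_iff_filterlim_real by blast
qed

lemma compact_real_finite_net:
  fixes S :: "real set"
  assumes "compact S" "0 < h"
  obtains Q where "finite Q" "\<And>s. s \<in> S \<Longrightarrow> \<exists>q\<in>Q. \<bar>s - q\<bar> \<le> h"
proof -
  from assms obtain Q where Q: "finite Q" "S \<subseteq> (\<Union>x\<in>Q. ball x h)"
    unfolding compact_eq_totally_bounded by blast
  have "\<exists>q\<in>Q. \<bar>s - q\<bar> \<le> h" if "s \<in> S" for s
    using Q(2) that by (force simp: dist_real_def abs_minus_commute)
  with Q(1) show ?thesis by (rule that)
qed

section \<open>Limit means of bounded functions along an orbit, as functions of the scale\<close>

locale orbit_limit =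
  fixes T :: "'a \<Rightarrow> 'a" and a :: "nat \<Rightarrow> nat" and x :: 'a and G :: "nat filter"
  assumes additive: "additive_fun a"
    and fin_values: "finite (a ` {p. prime p})"
    and G_le: "G \<le> sequentially"
    and G_ne: "G \<noteq> bot"
    and G_universal: "\<And>h :: nat \<Rightarrow> real. bounded (range h) \<Longrightarrow> \<exists>l. (h \<longlongrightarrow> l) G"
begin

definition orbit_values :: "('a \<Rightarrow> real) \<Rightarrow> nat \<Rightarrow> real" where
  "orbit_values g n = g ((T ^^ a n) x)"

text \<open>This is \<open>U g s\<close> of the overview. For bounded \<open>g\<close> the limit
  exists because \<open>G\<close> is universal; otherwise \<open>Lim\<close> may be
  arbitrary.\<close>

definition lim_mean :: "('a \<Rightarrow> real) \<Rightarrow> real \<Rightarrow> real" where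
  "lim_mean g s = Lim G (\<lambda>N. cmean (orbit_values g) (dilate s N))"

lemma lim_mean_tendsto:
  assumes "\<And>y. \<bar>g y\<bar> \<le> B"
  shows "((\<lambda>N. cmean (orbit_values g) (dilate s N)) \<longlongrightarrow> lim_mean g s) G"
proof -
  have "\<bar>cmean (orbit_values g) M\<bar> \<le> B" for M
    using assms by (intro abs_cmean_le) (simp add: orbit_values_def)
  then have "bounded (range (\<lambda>N. cmean (orbit_values g) (dilate s N)))"
    by (auto simp: bounded_iff)
  then obtain l where "((\<lambda>N. cmean (orbit_values g) (dilate s N)) \<longlongrightarrow> l) G"
    using G_universal by blast
  then show ?thesis
    unfolding lim_mean_def using tendsto_Lim[OF G_ne] by metis
qed

text \<open>The ratio of the two ranges of summation tends to \<open>exp (s - s')\<close>, and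
  \<open>1 - exp (- d) \<le> d\<close>. This bound lets finitely many values of \<open>s\<close>
  control a whole interval.\<close>

lemma lim_mean_Lipschitz:
  assumes B: "\<And>y. \<bar>g y\<bar> \<le> B"
  shows "\<bar>lim_mean g s - lim_mean g s'\<bar> \<le> 2 * B * \<bar>s - s'\<bar>"
proof -
  have B0: "0 \<le> B" using B[of x] by linarith
  have *: "\<bar>lim_mean g s - lim_mean g s'\<bar> \<le> 2 * B * (s' - s)" if "s \<le> s'" for s s'
  proof -
    have "((\<lambda>N. \<bar>cmean (orbit_values g) (dilate s N) - cmean (orbit_values g) (dilate s' N)\<bar>) \<longlongrightarrow> \<bar>lim_mean g s - lim_mean g s'\<bar>) G"
      by (intro tendsto_intros lim_mean_tendsto[of g B] B)
    moreover have "((\<lambda>N. 2 * B * (1 - (real (dilate s N) / real N) / (real (dilate s' N) / real N)))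
      \<longlongrightarrow> 2 * B * (1 - exp s / exp s')) G"
      by (intro tendsto_intros tendsto_mono[OF G_le tendsto_dilate]) simp
    moreover have "\<forall>\<^sub>F N in G. \<bar>cmean (orbit_values g) (dilate s N) - cmean (orbit_values g) (dilate s' N)\<bar>
      \<le> 2 * B * (1 - (real (dilate s N) / real N) / (real (dilate s' N) / real N))"
    proof (rule filter_leD[OF G_le])
      have "\<forall>\<^sub>F N in sequentially. dilate s N \<ge> 1"
        using filterlim_dilate[of s] by (simp add: filterlim_at_top)
      then show "\<forall>\<^sub>F N in sequentially. \<bar>cmean (orbit_values g) (dilate s N) - cmean (orbit_values g) (dilate s' N)\<bar>
      \<le> 2 * B * (1 - (real (dilate s N) / real N) / (real (dilate s' N) / real N))"
        using eventually_gt_at_top[of 0]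
      proof eventually_elim
        case (elim N)
        have "\<bar>orbit_values g n\<bar> \<le> B" for n using B by (simp add: orbit_values_def)
        from cmean_diff_le[OF this dilate_mono[OF that]] elim show ?case by simp
      qed
    qed
    ultimately have "\<bar>lim_mean g s - lim_mean g s'\<bar> \<le> 2 * B * (1 - exp s / exp s')"
      using tendsto_le[OF G_ne] by blast
    also have "\<dots> \<le> 2 * B * (s' - s)"
    proof (intro mult_left_mono)
      show "1 - exp s / exp s' \<le> s' - s"
        using exp_ge_add_one_self[of "s - s'"] by (simp add: exp_diff)
    qed (use B0 in simp)
    finally show ?thesis .
  qed
  show ?thesis
    using *[of s s'] *[of s' s] by (cases "s \<le> s'") (auto simp: abs_minus_commute)
qed

text \<open>The gain is the square root: the trivial bound is linear in the sum of
  \<open>1 / p\<close>. The constant 4 comes from bounding the sum of \<open>1 / p^2\<close> by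
  2.\<close>

lemma lim_mean_turan_kubilius:
  assumes F: "finite F" "\<And>p. p \<in> F \<Longrightarrow> prime p" and B: "\<And>y. \<bar>g y\<bar> \<le> B"
  shows "\<bar>\<Sum>p\<in>F. 1 / real p * (lim_mean (g \<circ> T ^^ a p) (s - ln (real p)) - lim_mean g s)\<bar>
    \<le> B * sqrt (\<Sum>p\<in>F. 1 / real p) + 4 * B"
proof -
  have B0: "0 \<le> B" using B[of x] by linarith
  have "\<bar>\<Sum>p\<in>F. 1 / real p * (lim_mean (g \<circ> T ^^ a p) (s - ln (real p)) - lim_mean g s)\<bar>
    \<le> B * sqrt (\<Sum>p\<in>F. 1 / real p) + 2 * B * (\<Sum>p\<in>F. 1 / (real p)\<^sup>2)"
  proof (rule turan_kubilius_dual[OF F, where \<phi> = "orbit_values g" and \<psi> = "\<lambda>p. orbit_values (g \<circ> T ^^ a p)" and G = G and M = "dilate s"])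
    show "orbit_values g (p * n) = orbit_values (g \<circ> T ^^ a p) n" if "p \<in> F" "n > 0" "\<not> p dvd n" for p n
    proof -
      have "coprime p n" "p > 0"
        using F(2)[OF that(1)] that(3) by (simp_all add: prime_imp_coprime prime_gt_0_nat)
      then have "a (p * n) = a p + a n"
        using additive that(2) by (simp add: additive_fun_def)
      then show ?thesis by (simp add: orbit_values_def funpow_add)
    qed
    show "filterlim (dilate s) at_top G"
      by (rule filterlim_mono[OF filterlim_dilate order_refl G_le])
    show "((\<lambda>i. cmean (orbit_values (g \<circ> T ^^ a p)) (dilate s i div p)) \<longlongrightarrow> lim_mean (g \<circ> T ^^ a p) (s - ln (real p))) G"
      if "p \<in> F" for p
    proof -
      have "p > 0" using F(2)[OF that] by (simp add: prime_gt_0_nat)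
      then show ?thesis
        unfolding dilate_div[OF \<open>p > 0\<close>] using B by (intro lim_mean_tendsto[of _ B]) simp
    qed
  qed (use B G_ne lim_mean_tendsto[of g B] in \<open>auto simp: orbit_values_def\<close>)
  also have "2 * B * (\<Sum>p\<in>F. 1 / (real p)\<^sup>2) \<le> 2 * B * 2"
    using B0 F(1) by (intro mult_left_mono sum_inverse_squares_finite_le) auto
  finally show ?thesis by simp
qed

definition exceptional_primes :: "('a \<Rightarrow> real) \<Rightarrow> real \<Rightarrow> real \<Rightarrow> nat set" where
  "exceptional_primes g s \<eta> = {p. prime p \<and> \<eta> \<le> \<bar>lim_mean (g \<circ> T ^^ a p) (s - ln (real p)) - lim_mean g s\<bar>}"

text \<open>Let \<open>L\<close> be the sum of \<open>1 / p\<close> over a finite set of exceptional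
  primes whose deviations have one sign. Nothing cancels, so
  \<open>\<eta> * L \<le> B * sqrt L + 4 * B\<close>, which bounds \<open>L\<close> independently of
  the set.\<close>

lemma summable_on_exceptional_primes:
  assumes B: "\<And>y. \<bar>g y\<bar> \<le> B" and \<eta>: "0 < \<eta>"
  shows "(\<lambda>p. 1 / real p) summable_on exceptional_primes g s \<eta>"
proof -
  have B0: "0 \<le> B" using B[of x] by linarith
  \<comment> \<open>The summand 1 covers the case \<open>L \<le> 1\<close>. For \<open>L > 1\<close>
    one has \<open>4 * B \<le> 4 * B * sqrt L\<close>, hence
    \<open>sqrt L \<le> 5 * B / \<eta>\<close>.\<close>
  define C where "C = 1 + (5 * B / \<eta>)\<^sup>2"
  define d where "d p = lim_mean (g \<circ> T ^^ a p) (s - ln (real p)) - lim_mean g s" for p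
  have *: "(\<Sum>p\<in>F. 1 / real p) \<le> C"
    if F: "finite F" "\<And>p. p \<in> F \<Longrightarrow> prime p" "(\<forall>p\<in>F. \<eta> \<le> d p) \<or> (\<forall>p\<in>F. \<eta> \<le> - d p)" for F
  proof (cases "(\<Sum>p\<in>F. 1 / real p) \<le> 1")
    case True
    then show ?thesis by (simp add: C_def add_increasing2)
  next
    case False
    define L where "L = (\<Sum>p\<in>F. 1 / real p)"
    have L: "1 < L" using False by (simp add: L_def)
    have "\<eta> * L \<le> \<bar>\<Sum>p\<in>F. 1 / real p * d p\<bar>"
      using F(3)
    proof
      assume "\<forall>p\<in>F. \<eta> \<le> d p"
      then have "(\<Sum>p\<in>F. 1 / real p * \<eta>) \<le> (\<Sum>p\<in>F. 1 / real p * d p)"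
        by (intro sum_mono mult_left_mono) auto
      then show ?thesis by (simp add: L_def sum_distrib_left)
    next
      assume "\<forall>p\<in>F. \<eta> \<le> - d p"
      then have "(\<Sum>p\<in>F. 1 / real p * \<eta>) \<le> (\<Sum>p\<in>F. 1 / real p * - d p)"
        by (intro sum_mono mult_left_mono) auto
      then show ?thesis by (simp add: L_def sum_distrib_left sum_negf)
    qed
    also have "\<dots> \<le> B * sqrt L + 4 * B"
      using lim_mean_turan_kubilius[of F g B s, OF F(1,2) B] by (simp only: d_def L_def)
    also have "\<dots> \<le> B * sqrt L + 4 * B * sqrt L"
      using L B0 by (intro add_left_mono) (simp add: mult_le_cancel_left1)
    finally have "(\<eta> * sqrt L) * sqrt L \<le> (5 * B) * sqrt L"
      using L by (simp add: mult.assoc)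
    then have "\<eta> * sqrt L \<le> 5 * B"
      by (rule mult_right_le_imp_le) (use L in simp)
    then have "sqrt L \<le> 5 * B / \<eta>" using \<eta> by (simp add: field_simps)
    then have "L \<le> (5 * B / \<eta>)\<^sup>2"
      using L sqrt_le_D by blast
    then show ?thesis by (simp add: C_def L_def)
  qed
  show ?thesis
  proof (rule nonneg_bdd_above_summable_on)
    show "bdd_above (sum (\<lambda>p. 1 / real p) ` {F. F \<subseteq> exceptional_primes g s \<eta> \<and> finite F})"
    proof (rule bdd_aboveI2)
      fix F assume "F \<in> {F. F \<subseteq> exceptional_primes g s \<eta> \<and> finite F}"
      then have F: "F \<subseteq> exceptional_primes g s \<eta>" "finite F" by auto
      have "(\<Sum>p\<in>F. 1 / real p) = (\<Sum>p\<in>{p\<in>F. 0 \<le> d p}. 1 / real p) + (\<Sum>p\<in>{p\<in>F. \<not> 0 \<le> d p}. 1 / real p)"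
        using F(2) by (subst sum.union_disjoint[symmetric]) (auto intro!: sum.cong)
      also have "\<dots> \<le> C + C"
        using F by (intro add_mono *) (auto simp: exceptional_primes_def d_def)
      finally show "(\<Sum>p\<in>F. 1 / real p) \<le> C + C" .
    qed
  qed simp
qed

text \<open>For two non-exceptional primes \<open>p\<close>, \<open>q\<close> with \<open>a p = a q\<close>, both \<open>lim_mean g s\<close> and
  \<open>lim_mean g (s + ln q - ln p)\<close> are close to \<open>lim_mean (g \<circ> T ^^ a p) (s - ln p)\<close>.\<close>
lemma lim_mean_almost_period:
  assumes B: "\<And>y. \<bar>g y\<bar> \<le> B" and \<epsilon>: "0 < \<epsilon>"
  obtains \<delta> where "0 < \<delta>" "\<delta> \<le> \<epsilon>"
    "\<And>\<eta> S. 0 < \<eta> \<Longrightarrow> \<exists>r\<in>{\<delta>..\<epsilon>}. \<forall>s\<in>{- S..S}. \<bar>lim_mean g s - lim_mean g (s + r)\<bar> \<le> \<eta>"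
proof -
  have B0: "0 \<le> B" using B[of x] by linarith
  obtain \<delta> where \<delta>: "0 < \<delta>" "\<delta> \<le> \<epsilon>"
    and gap: "\<And>E. (\<lambda>p. 1 / real p) summable_on E \<Longrightarrow>
      \<exists>p q. prime p \<and> prime q \<and> p \<notin> E \<and> q \<notin> E \<and> a p = a q \<and>
       \<delta> \<le> ln (real q) - ln (real p) \<and> ln (real q) - ln (real p) \<le> \<epsilon>"
    using monochromatic_primes_moderate_gap[OF fin_values \<epsilon>] by blast
  have "\<exists>r\<in>{\<delta>..\<epsilon>}. \<forall>s\<in>{- S..S}. \<bar>lim_mean g s - lim_mean g (s + r)\<bar> \<le> \<eta>" if \<eta>: "0 < \<eta>" for \<eta> S
  proof -
    \<comment> \<open>Passing from \<open>s\<close> to \<open>s + r\<close> through net points costs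
      Lipschitz errors \<open>2 * B * h\<close>, \<open>4 * B * h\<close> and
      \<open>2 * B * h\<close>, together at most \<open>\<eta> / 2\<close>, and the two
      non-exceptional primes cost \<open>\<eta> / 4\<close> each. \<open>B + 1\<close> avoids
      division by zero.\<close>
    define h where "h = \<eta> / (16 * (B + 1))"
    have h: "0 < h" using \<eta> B0 by (simp add: h_def)
    have "16 * (B + 1) * h = \<eta>" using B0 by (simp add: h_def)
    then have Bh: "16 * (B * h) \<le> \<eta>" using h by (simp add: algebra_simps)
    \<comment> \<open>The exceptional set depends on the scale, and only a finite union of such sets
      is known to have summable reciprocals. The net reaches up to \<open>S + \<epsilon>\<close>
      because \<open>s + r\<close> must be approximated too.\<close>
    obtain Q where Q: "finite Q" "\<And>s. s \<in> {- S..S + \<epsilon>} \<Longrightarrow> \<exists>q\<in>Q. \<bar>s - q\<bar> \<le> h"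
      using compact_real_finite_net[OF compact_Icc h] by metis
    have "(\<lambda>p. 1 / real p) summable_on (\<Union>t\<in>Q. exceptional_primes g t (\<eta> / 4))"
      using Q(1) \<eta> by (intro summable_on_finite_UN summable_on_exceptional_primes[OF B]) auto
    from gap[OF this] obtain p q where pq: "prime p" "prime q" "a p = a q"
      "p \<notin> (\<Union>t\<in>Q. exceptional_primes g t (\<eta> / 4))" "q \<notin> (\<Union>t\<in>Q. exceptional_primes g t (\<eta> / 4))"
      "\<delta> \<le> ln (real q) - ln (real p)" "ln (real q) - ln (real p) \<le> \<epsilon>" by blast
    define r where "r = ln (real q) - ln (real p)"
    define g' where "g' = g \<circ> T ^^ a p"
    have g': "\<bar>g' y\<bar> \<le> B" for y using B by (simp add: g'_def)
    have "\<bar>lim_mean g s - lim_mean g (s + r)\<bar> \<le> \<eta>" if s: "s \<in> {- S..S}" for s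
    proof -
      have "s \<in> {- S..S + \<epsilon>}" "s + r \<in> {- S..S + \<epsilon>}"
        using s pq \<delta> \<epsilon> by (auto simp: r_def)
      then obtain s1 s2 where s1: "s1 \<in> Q" "\<bar>s - s1\<bar> \<le> h" and s2: "s2 \<in> Q" "\<bar>s + r - s2\<bar> \<le> h"
        using Q(2) by meson
      have 1: "\<bar>lim_mean g s - lim_mean g s1\<bar> \<le> 2 * (B * h)"
        using lim_mean_Lipschitz[of g B s s1, OF B] mult_left_mono[OF s1(2) B0] by simp
      have 2: "\<bar>lim_mean g' (s1 - ln (real p)) - lim_mean g s1\<bar> \<le> \<eta> / 4"
        using pq(1,4) s1(1) by (fastforce simp: exceptional_primes_def g'_def)
      have 3: "\<bar>lim_mean g' (s1 - ln (real p)) - lim_mean g' (s2 - ln (real q))\<bar> \<le> 4 * (B * h)"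
      proof -
        have "\<bar>(s1 - ln (real p)) - (s2 - ln (real q))\<bar> \<le> 2 * h"
          using s1(2) s2(2) by (simp add: r_def)
        from mult_left_mono[OF this B0] lim_mean_Lipschitz[of g' B "s1 - ln (real p)" "s2 - ln (real q)"] g'
        show ?thesis by simp
      qed
      have 4: "\<bar>lim_mean g' (s2 - ln (real q)) - lim_mean g s2\<bar> \<le> \<eta> / 4"
        using pq(2,3,5) s2(1) by (fastforce simp: exceptional_primes_def g'_def)
      have 5: "\<bar>lim_mean g s2 - lim_mean g (s + r)\<bar> \<le> 2 * (B * h)"
        using lim_mean_Lipschitz[of g B s2 "s + r", OF B] mult_left_mono[OF s2(2) B0] by (simp add: abs_minus_commute)
      from 1 2 3 4 5 Bh show ?thesis by linarith
    qed
    moreover have "r \<in> {\<delta>..\<epsilon>}" using pq by (simp add: r_def)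
    ultimately show ?thesis by blast
  qed
  with \<delta> that show ?thesis by blast
qed

text \<open>Almost periods for tolerances tending to 0 on growing intervals accumulate in the
  compact set from \<delta> to \<epsilon>. By the Lipschitz bound an accumulation point is an exact
  period, and it is positive because \<delta> does not depend on the tolerance.\<close>

lemma lim_mean_period:
  assumes B: "\<And>y. \<bar>g y\<bar> \<le> B" and \<epsilon>: "0 < \<epsilon>"
  obtains r where "0 < r" "r \<le> \<epsilon>" "\<And>s. lim_mean g (s + r) = lim_mean g s"
proof -
  have B0: "0 \<le> B" using B[of x] by linarith
  obtain \<delta> where \<delta>: "0 < \<delta>" "\<delta> \<le> \<epsilon>"
    and ap: "\<And>\<eta> S. 0 < \<eta> \<Longrightarrow> \<exists>r\<in>{\<delta>..\<epsilon>}. \<forall>s\<in>{- S..S}. \<bar>lim_mean g s - lim_mean g (s + r)\<bar> \<le> \<eta>"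
    by (rule lim_mean_almost_period[of g B \<epsilon>, OF B \<epsilon>]) (rule that)
  have "\<exists>r\<in>{\<delta>..\<epsilon>}. \<forall>s\<in>{- real n..real n}. \<bar>lim_mean g s - lim_mean g (s + r)\<bar> \<le> 1 / real (Suc n)" for n
    by (rule ap) simp
  then obtain r where r: "\<And>n. r n \<in> {\<delta>..\<epsilon>}"
    "\<And>n s. s \<in> {- real n..real n} \<Longrightarrow> \<bar>lim_mean g s - lim_mean g (s + r n)\<bar> \<le> 1 / real (Suc n)"
    by metis
  have "seq_compact {\<delta>..\<epsilon>}" by (intro compact_imp_seq_compact compact_Icc)
  then obtain l \<sigma> where l: "l \<in> {\<delta>..\<epsilon>}" "strict_mono \<sigma>" "(r \<circ> \<sigma>) \<longlonglongrightarrow> l"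
    using seq_compactE[of _ r] r(1) by blast
  have "lim_mean g (s + l) = lim_mean g s" for s
  proof -
    have "(\<lambda>n. 1 / real (Suc (\<sigma> n)) + 2 * B * \<bar>(r \<circ> \<sigma>) n - l\<bar>) \<longlonglongrightarrow> 0 + 2 * B * \<bar>l - l\<bar>"
      using filterlim_compose[OF LIMSEQ_Suc[OF lim_1_over_n[where 'a=real]] filterlim_subseq[OF l(2)]]
      by (intro tendsto_intros l(3)) simp
    moreover have "\<forall>\<^sub>F n in sequentially. \<bar>lim_mean g s - lim_mean g (s + l)\<bar> \<le> 1 / real (Suc (\<sigma> n)) + 2 * B * \<bar>(r \<circ> \<sigma>) n - l\<bar>"
    proof (rule eventually_sequentiallyI)
      fix n assume n: "nat \<lceil>\<bar>s\<bar>\<rceil> \<le> n"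
      have "n \<le> \<sigma> n" using l(2) by (rule seq_suble)
      with n have "\<bar>s\<bar> \<le> real (\<sigma> n)" by linarith
      then have "\<bar>lim_mean g s - lim_mean g (s + r (\<sigma> n))\<bar> \<le> 1 / real (Suc (\<sigma> n))"
        by (intro r(2)) auto
      moreover have "\<bar>lim_mean g (s + r (\<sigma> n)) - lim_mean g (s + l)\<bar> \<le> 2 * B * \<bar>r (\<sigma> n) - l\<bar>"
        using lim_mean_Lipschitz[of g B "s + r (\<sigma> n)" "s + l", OF B] by simp
      ultimately show "\<bar>lim_mean g s - lim_mean g (s + l)\<bar> \<le> 1 / real (Suc (\<sigma> n)) + 2 * B * \<bar>(r \<circ> \<sigma>) n - l\<bar>"
        by simp
    qed
    ultimately have "\<bar>lim_mean g s - lim_mean g (s + l)\<bar> \<le> 0 + 2 * B * \<bar>l - l\<bar>"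
      using tendsto_lowerbound by fastforce
    then show ?thesis by simp
  qed
  moreover have "0 < l" "l \<le> \<epsilon>" using l(1) \<delta> by auto
  ultimately show ?thesis using that by blast
qed

text \<open>Moving \<open>s'\<close> back by multiples of a period of size at most \<epsilon>
  reaches a point within \<epsilon> of \<open>s\<close>; the Lipschitz bound then makes the
  difference as small as desired.\<close>

lemma lim_mean_const:
  assumes B: "\<And>y. \<bar>g y\<bar> \<le> B"
  shows "lim_mean g s = lim_mean g s'"
proof -
  have B0: "0 \<le> B" using B[of x] by linarith
  have *: "lim_mean g s = lim_mean g s'" if le: "s \<le> s'" for s s'
  proof -
    have le_e: "\<bar>lim_mean g s - lim_mean g s'\<bar> \<le> e" if e: "0 < e" for e
    proof -
      define \<epsilon> where "\<epsilon> = e / (2 * (B + 1))"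
      have \<epsilon>: "0 < \<epsilon>" using e B0 by (simp add: \<epsilon>_def)
      have "2 * (B + 1) * \<epsilon> = e" using B0 by (simp add: \<epsilon>_def)
      then have e_ge: "2 * B * \<epsilon> \<le> e" using \<epsilon> by (simp add: algebra_simps)
      obtain r where r: "0 < r" "r \<le> \<epsilon>" "\<And>s. lim_mean g (s + r) = lim_mean g s"
        by (rule lim_mean_period[of g B \<epsilon>, OF B \<epsilon>]) (rule that)
      have per: "lim_mean g (t + real k * r) = lim_mean g t" for t k
      proof (induction k)
        case (Suc k)
        have "lim_mean g (t + real (Suc k) * r) = lim_mean g ((t + real k * r) + r)"
          by (simp add: algebra_simps)
        also have "\<dots> = lim_mean g (t + real k * r)" by (rule r(3))
        also have "\<dots> = lim_mean g t" by (rule Suc.IH)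
        finally show ?case .
      qed simp
      define k where "k = nat \<lfloor>(s' - s) / r\<rfloor>"
      define t where "t = s' - real k * r"
      have "0 \<le> (s' - s) / r" using le r by simp
      then have "real k \<le> (s' - s) / r" "(s' - s) / r < real k + 1"
        unfolding k_def by linarith+
      then have "real k * r \<le> s' - s" "s' - s < (real k + 1) * r"
        using r(1) by (simp_all only: pos_le_divide_eq pos_divide_less_eq)
      then have "s \<le> t" "t - s \<le> r"
        by (simp_all add: t_def distrib_right)
      then have "\<bar>s - t\<bar> \<le> \<epsilon>" using r(2) by simp
      have "lim_mean g s' = lim_mean g t" using per[of t k] by (simp only: t_def diff_add_cancel)
      then have "\<bar>lim_mean g s - lim_mean g s'\<bar> \<le> 2 * B * \<bar>s - t\<bar>"
        using lim_mean_Lipschitz[of g B s t, OF B] by simp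
      also have "\<dots> \<le> 2 * B * \<epsilon>"
        using \<open>\<bar>s - t\<bar> \<le> \<epsilon>\<close> B0 by (intro mult_left_mono) auto
      finally show ?thesis using e_ge by simp
    qed
    have "\<bar>lim_mean g s - lim_mean g s'\<bar> \<le> 0"
    proof (rule field_le_epsilon)
      fix e :: real assume "0 < e"
      then show "\<bar>lim_mean g s - lim_mean g s'\<bar> \<le> 0 + e" using le_e[of e] by simp
    qed
    then show ?thesis by simp
  qed
  show ?thesis using linear[of s s'] by (elim disjE) (simp_all only: *[of s s'] *[of s' s])
qed

text \<open>Constancy in the scale removes the shift by \<open>ln p\<close>, so the deviation is the
  same for all primes with \<open>a p = c\<close>. Were it nonzero, all these primes would be
  exceptional, against the divergence.\<close>

lemma lim_mean_invariant:
  assumes B: "\<And>y. \<bar>g y\<bar> \<le> B"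
    and c: "\<not> (\<lambda>p. 1 / real p) summable_on {p. prime p \<and> a p = c}"
  shows "lim_mean (g \<circ> T ^^ c) s = lim_mean g s"
proof (rule ccontr)
  assume "lim_mean (g \<circ> T ^^ c) s \<noteq> lim_mean g s"
  then have \<eta>: "0 < \<bar>lim_mean (g \<circ> T ^^ c) s - lim_mean g s\<bar>" (is "0 < ?\<eta>") by simp
  have "{p. prime p \<and> a p = c} \<subseteq> exceptional_primes g s ?\<eta>"
  proof clarify
    fix p assume "prime p" "c = a p"
    moreover have "lim_mean (g \<circ> T ^^ c) (s - ln (real p)) = lim_mean (g \<circ> T ^^ c) s"
      using B by (intro lim_mean_const[of _ B]) simp
    ultimately show "p \<in> exceptional_primes g s \<bar>lim_mean (g \<circ> T ^^ a p) s - lim_mean g s\<bar>" by (simp add: exceptional_primes_def)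
  qed
  then have "(\<lambda>p. 1 / real p) summable_on {p. prime p \<and> a p = c}"
    by (rule summable_on_subset_banach[OF summable_on_exceptional_primes[of g B, OF B \<eta>]])
  with c show False by blast
qed

end

section \<open>From limit means to the invariant measure and the theorem\<close>

lemma continuous_on_compact_bounded:
  fixes g :: "'a::metric_space \<Rightarrow> real"
  assumes "compact (UNIV :: 'a set)" "continuous_on UNIV g"
  obtains B where "\<And>y. \<bar>g y\<bar> \<le> B"
proof -
  have "bounded (range g)"
    using assms by (intro compact_imp_bounded compact_continuous_image)
  then obtain B where "\<forall>z\<in>range g. norm z \<le> B" unfolding bounded_iff ..
  then show ?thesis by (intro that[of B]) simp
qed

locale compact_orbit_limit = orbit_limit T a x G
  for T :: "'a::metric_space \<Rightarrow> 'a" and a x G +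
  assumes cpt: "compact (UNIV :: 'a set)"
    and T: "continuous_on UNIV T"
begin

lemma lim_mean_0_tendsto:
  assumes "continuous_on UNIV g"
  shows "((\<lambda>N. cmean (orbit_values g) N) \<longlongrightarrow> lim_mean g 0) G"
proof -
  obtain B where B: "\<And>y. \<bar>g y\<bar> \<le> B"
    by (rule continuous_on_compact_bounded[OF cpt assms]) (rule that)
  show ?thesis using lim_mean_tendsto[of g B 0, OF B] by (simp add: dilate_0)
qed

lemma lim_mean_0_eq: "\<lbrakk>continuous_on UNIV g; (cmean (orbit_values g) \<longlongrightarrow> l) G\<rbrakk> \<Longrightarrow> lim_mean g 0 = l"
  using lim_mean_0_tendsto tendsto_unique[OF G_ne] by blast

sublocale positive_functional "\<lambda>g. lim_mean g 0"
proof
  fix f g :: "'a \<Rightarrow> real" and c :: real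
  assume f: "continuous_on UNIV f"
  show "lim_mean (\<lambda>y. c * f y) 0 = c * lim_mean f 0"
  proof (rule lim_mean_0_eq)
    have "cmean (orbit_values (\<lambda>y. c * f y)) = (\<lambda>N. c * cmean (orbit_values f) N)"
      by (simp add: fun_eq_iff orbit_values_def[abs_def] cmean_cmult)
    then show "(cmean (orbit_values (\<lambda>y. c * f y)) \<longlongrightarrow> c * lim_mean f 0) G"
      using tendsto_mult_left[OF lim_mean_0_tendsto[OF f]] by simp
  qed (intro continuous_intros f)
  show "0 \<le> lim_mean f 0" if "\<And>y. 0 \<le> f y"
  proof (rule tendsto_lowerbound[OF lim_mean_0_tendsto[OF f] _ G_ne])
    show "\<forall>\<^sub>F N in G. 0 \<le> cmean (orbit_values f) N"
      using that by (intro always_eventually allI) (simp add: cmean_def orbit_values_def sum_nonneg)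
  qed
  assume g: "continuous_on UNIV g"
  show "lim_mean (\<lambda>y. f y + g y) 0 = lim_mean f 0 + lim_mean g 0"
  proof (rule lim_mean_0_eq)
    have "cmean (orbit_values (\<lambda>y. f y + g y)) = (\<lambda>N. cmean (orbit_values f) N + cmean (orbit_values g) N)"
      by (simp add: fun_eq_iff orbit_values_def[abs_def] cmean_add)
    then show "(cmean (orbit_values (\<lambda>y. f y + g y)) \<longlongrightarrow> lim_mean f 0 + lim_mean g 0) G"
      using tendsto_add[OF lim_mean_0_tendsto[OF f] lim_mean_0_tendsto[OF g]] by simp
  qed (intro continuous_intros f g)
next
  show "lim_mean (\<lambda>_. 1) 0 = 1"
  proof (rule lim_mean_0_eq)
    have "\<forall>\<^sub>F N in sequentially. cmean (orbit_values (\<lambda>_. 1)) N = 1"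
      using eventually_gt_at_top[of 0] by eventually_elim (simp add: orbit_values_def[abs_def] cmean_const)
    then have "\<forall>\<^sub>F N in G. cmean (orbit_values (\<lambda>_. 1)) N = 1"
      using G_le by (rule filter_leD[rotated])
    then show "(cmean (orbit_values (\<lambda>_. 1)) \<longlongrightarrow> 1) G" by (rule tendsto_eventually)
  qed simp
qed (rule cpt)

lemma borel_prob_riesz_measure: "borel_prob riesz_measure"
  by (simp add: borel_prob_def prob_space_riesz_measure)

lemma continuous_funpow: "continuous_on UNIV (T ^^ k)"
proof (induction k)
  case (Suc k)
  have "continuous_on UNIV (T \<circ> T ^^ k)"
    by (rule continuous_on_compose[OF Suc continuous_on_subset[OF T]]) simp
  then show ?case by simp
qed (simp add: id_def)

text \<open>Equality of Borel probability measures can be tested on continuous functions, where it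
  is \<open>lim_mean_invariant\<close> at scale 0 read through the Riesz representation.\<close>

lemma invariant_riesz_measure:
  assumes c: "\<not> (\<lambda>p. 1 / real p) summable_on {p. prime p \<and> a p = c}"
  shows "invariant_measure (T ^^ c) riesz_measure"
proof -
  have meas: "T ^^ c \<in> measurable riesz_measure riesz_measure"
    using borel_measurable_continuous_onI[OF continuous_funpow]
    by (simp add: measurable_cong_sets[OF sets_riesz_measure sets_riesz_measure])
  interpret prob_space riesz_measure by (rule prob_space_riesz_measure)
  have "distr riesz_measure riesz_measure (T ^^ c) = riesz_measure"
  proof (rule borel_prob_eqI[OF _ borel_prob_riesz_measure])
    show "borel_prob (distr riesz_measure riesz_measure (T ^^ c))"
      using prob_space_distr[OF meas] by (simp add: borel_prob_def)
    fix g :: "'a \<Rightarrow> real" assume g: "continuous_on UNIV g"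
    obtain B where B: "\<And>y. \<bar>g y\<bar> \<le> B"
      by (rule continuous_on_compact_bounded[OF cpt g]) (rule that)
    have gT: "continuous_on UNIV (g \<circ> T ^^ c)"
      by (rule continuous_on_compose[OF continuous_funpow continuous_on_subset[OF g]]) simp
    have "g \<in> borel_measurable riesz_measure"
      using borel_measurable_continuous_onI[OF g] by (simp add: measurable_cong_sets[OF sets_riesz_measure refl])
    then have "integral\<^sup>L (distr riesz_measure riesz_measure (T ^^ c)) g = integral\<^sup>L riesz_measure (g \<circ> T ^^ c)"
      by (simp add: integral_distr[OF meas] o_def)
    also have "\<dots> = integral\<^sup>L riesz_measure g"
      by (simp only: riesz_representation[OF g] riesz_representation[OF gT] lim_mean_invariant[of g B, OF B c])
    finally show "integral\<^sup>L (distr riesz_measure riesz_measure (T ^^ c)) g = integral\<^sup>L riesz_measure g" .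
  qed
  with meas show ?thesis by (simp add: invariant_measure_def)
qed

lemma lim_mean_0_eq_integral:
  assumes c: "\<not> (\<lambda>p. 1 / real p) summable_on {p. prime p \<and> a p = c}"
    and \<mu>: "uniquely_ergodic \<mu> (T ^^ c)" and g: "continuous_on UNIV g"
  shows "lim_mean g 0 = integral\<^sup>L \<mu> g"
proof -
  have "riesz_measure = \<mu>"
    using \<mu> borel_prob_riesz_measure invariant_riesz_measure[OF c] by (simp add: uniquely_ergodic_def)
  then show ?thesis using riesz_representation[OF g] by simp
qed

end

text \<open>If convergence fails, \<open>sequentially\<close> can be restricted to the
  \<open>N\<close> with error at least \<open>e\<close>. A universal filter finer than this still
  produces the integral as its limit, which contradicts the error bound.\<close>

lemma cmean_tendsto_integral:
  fixes T :: "'a::metric_space \<Rightarrow> 'a"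
  assumes cpt: "compact (UNIV :: 'a set)" and T: "continuous_on UNIV T"
    and a: "additive_fun a" "finite (a ` {p. prime p})"
    and c: "\<not> (\<lambda>p. 1 / real p) summable_on {p. prime p \<and> a p = c}"
    and \<mu>: "uniquely_ergodic \<mu> (T ^^ c)" and g: "continuous_on UNIV g"
  shows "cmean (\<lambda>n. g ((T ^^ a n) x)) \<longlonglongrightarrow> integral\<^sup>L \<mu> g"
proof (rule tendstoI, rule ccontr)
  fix e :: real assume "0 < e"
  define P where "P N \<longleftrightarrow> \<not> dist (cmean (\<lambda>n. g ((T ^^ a n) x)) N) (integral\<^sup>L \<mu> g) < e" for N
  assume "\<not> (\<forall>\<^sub>F N in sequentially. dist (cmean (\<lambda>n. g ((T ^^ a n) x)) N) (integral\<^sup>L \<mu> g) < e)"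
  then have ne: "inf sequentially (principal {N. P N}) \<noteq> bot"
    by (simp add: trivial_limit_def eventually_inf_principal P_def)
  obtain G where G: "G \<le> inf sequentially (principal {N. P N})" "G \<noteq> bot"
    "\<forall>h :: nat \<Rightarrow> real. bounded (range h) \<longrightarrow> (\<exists>l. (h \<longlongrightarrow> l) G)"
    using exists_universal_filter[OF ne] by blast
  interpret compact_orbit_limit T a x G
    by unfold_locales (use a cpt T G in auto)
  have "(cmean (orbit_values g) \<longlongrightarrow> integral\<^sup>L \<mu> g) G"
    using lim_mean_0_tendsto[OF g] lim_mean_0_eq_integral[OF c \<mu> g] by simp
  then have "\<forall>\<^sub>F N in G. dist (cmean (orbit_values g) N) (integral\<^sup>L \<mu> g) < e"
    using \<open>0 < e\<close> by (rule tendstoD)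
  moreover have "\<forall>\<^sub>F N in G. P N"
    using G(1) by (rule filter_leD) (simp add: eventually_inf_principal)
  ultimately have "\<forall>\<^sub>F N in G. False"
    by eventually_elim (simp add: P_def orbit_values_def[abs_def])
  with G(2) show False by (simp add: trivial_limit_def)
qed

theorem corollary1p18:
  fixes a :: "nat \<Rightarrow> nat"
    and P0 :: "nat set"
    and T :: "'a::metric_space \<Rightarrow> 'a"
    and \<mu> :: "'a measure"
    and f :: "'a \<Rightarrow> complex"
    and x :: 'a
  assumes "compact (UNIV :: 'a set)"
    and "additive_fun a"
    and "finite {a p | p. prime p}"
    and "P0 = {p. prime p \<and> a p \<noteq> 0}"
    and "\<not> (\<lambda>p. 1 / real p) summable_on P0"
    and "continuous_on UNIV T"
    and "borel_prob \<mu>"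
    and "\<And>p. p \<in> P0 \<Longrightarrow> uniquely_ergodic \<mu> (T ^^ a p)"
    and "continuous_on UNIV f"
  shows "(\<lambda>N. (1 / of_nat N) * (\<Sum>n = 1..N. f ((T ^^ a n) x))) \<longlonglongrightarrow> (\<integral>y. f y \<partial>\<mu>)"
proof -
  note cpt = assms(1) and f = assms(9)
  have fin: "finite (a ` {p. prime p})"
    using assms(3) unfolding setcompr_eq_image .
  \<comment> \<open>Finitely many values split the divergent sum over \<open>P0\<close>, so one
    nonzero value \<open>c\<close> carries a divergent part; unique ergodicity of
    \<open>T ^^ c\<close> for this single \<open>c\<close> is then enough.\<close>
  have "\<exists>c\<in>a ` P0. \<not> (\<lambda>p. 1 / real p) summable_on {p. prime p \<and> a p = c}"
  proof (rule ccontr)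
    assume "\<not> ?thesis"
    moreover have "finite (a ` P0)"
      by (rule finite_subset[OF _ fin]) (auto simp: assms(4))
    ultimately have "(\<lambda>p. 1 / real p) summable_on (\<Union>c\<in>a ` P0. {p. prime p \<and> a p = c})"
      by (intro summable_on_finite_UN) auto
    moreover have "(\<Union>c\<in>a ` P0. {p. prime p \<and> a p = c}) = P0"
      by (auto simp: assms(4))
    ultimately show False using assms(5) by simp
  qed
  then obtain c where c: "\<not> (\<lambda>p. 1 / real p) summable_on {p. prime p \<and> a p = c}" and \<mu>: "uniquely_ergodic \<mu> (T ^^ c)"
    using assms(8) by blast
  interpret prob_space \<mu> using assms(7) by (simp add: borel_prob_def)
  have sets: "sets \<mu> = sets borel" using assms(7) by (simp add: borel_prob_def)
  have "bounded (range f)"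
    using cpt f by (intro compact_imp_bounded compact_continuous_image)
  then obtain B where B: "\<And>y. norm (f y) \<le> B" by (auto simp: bounded_iff)
  have int: "integrable \<mu> f"
    using B borel_measurable_continuous_onI[OF f]
    by (intro integrable_const_bound[of _ B]) (auto simp: measurable_cong_sets[OF sets refl])
  have lim: "cmean (\<lambda>n. g ((T ^^ a n) x)) \<longlonglongrightarrow> integral\<^sup>L \<mu> g" if "continuous_on UNIV g" for g
    using cmean_tendsto_integral[OF cpt assms(6,2) fin c \<mu> that] .
  have mean: "(1 / of_nat N) * (\<Sum>n = 1..N. f ((T ^^ a n) x)) = (\<Sum>n = 1..N. f ((T ^^ a n) x)) / of_nat N" for N
    by simp
  have parts: "Re ((1 / of_nat N) * (\<Sum>n = 1..N. f ((T ^^ a n) x))) = cmean (\<lambda>n. Re (f ((T ^^ a n) x))) N"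
    "Im ((1 / of_nat N) * (\<Sum>n = 1..N. f ((T ^^ a n) x))) = cmean (\<lambda>n. Im (f ((T ^^ a n) x))) N" for N
    by (simp_all only: mean Re_divide_of_nat Im_divide_of_nat Re_sum Im_sum cmean_def)
  have "cmean (\<lambda>n. Re (f ((T ^^ a n) x))) \<longlonglongrightarrow> Re (\<integral>y. f y \<partial>\<mu>)"
    "cmean (\<lambda>n. Im (f ((T ^^ a n) x))) \<longlonglongrightarrow> Im (\<integral>y. f y \<partial>\<mu>)"
    using lim[OF continuous_on_Re[OF f]] lim[OF continuous_on_Im[OF f]]
    unfolding integral_Re[OF int] integral_Im[OF int] .
  then show ?thesis
    unfolding tendsto_complex_iff parts by (rule conjI)
qed

end
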